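(* Let $(R,B)$ be a fusion ring with $|B/G_R|=2$. There is a bijection between $\mathrm{Irr}_{H_R}(G_R)$ and $\mathrm{Irr}_0(R)$. Moreover, if $\psi\in\mathrm{Irr}_0(R)$, then its formal codegree is $f_\psi=|G_R|/\dim(\psi)$.
   Context: A fusion ring $(R,B)$ is an associative unital ring $R$, free of finite rank as a $\mathbb{Z}$-module, with a distinguished basis $B=\{b_i\}_{i\in I}\ni b_0=1_R$ such that $b_ib_j=\sum_kc_{i,j}^kb_k$ with $c_{i,j}^k\in\mathbb{Z}_{\geq0}$, and an involution $i\mapsto i^\ast$ of $I$ such that $b_i\mapsto b_i^\ast:=b_{i^\ast}$ extends linearly to an anti-involution of $R$ and $c_{i,j}^0=\delta_{i,j^\ast}$. $G_R\subset B$ is the finite group of invertible basis elements (those $x\in B$ with $xx^\ast=x^\ast x=1_R$), acting on $B$ by left multiplication; $B/G_R$ is the set of orbits. When $|B/G_R|=2$, the stabilizer in $G_R$ of $x\in B\setminus G_R$ does not depend on $x$ and is a normal subgroup of $G_R$, denoted $H_R$. For a finite group $G$ and subgroup $H$, $\mathrm{Irr}_H(G)$ is the set of isomorphism classes of irreducible complex representations $\psi$ of $G$ such that the restriction $\psi|_H$ is a sum of nontrivial irreducible representations of $H$. $\mathrm{Irr}(R)$ is the set of isomorphism classes of irreducible finite-dimensional representations of the semisimple algebra $R\otimes_{\mathbb{Z}}\mathbb{C}$, and $\mathrm{Irr}_0(R)\subset\mathrm{Irr}(R)$ is the subset of those $\psi$ with $\psi(x)=0$ for all $x\in B\setminus G_R$.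 For $\psi\in\mathrm{Irr}(R)$, the element $\sum_{x\in B}\mathrm{Tr}(x,\psi)x^\ast$ is central in $R\otimes_{\mathbb{Z}}\mathbb{C}$, where $\mathrm{Tr}(x,\psi)$ is the trace of $x$ acting on $\psi$; the formal codegree $f_\psi\in\mathbb{C}$ is the scalar by which it acts on $\psi$. *)

theory Defs
  imports
    "HOL-Algebra.Group_Action"
    "Jordan_Normal_Form.VS_Connect"
begin

section \<open>Fusion rings\<close>

definition int_expansion :: "('a, 'm) ring_scheme \<Rightarrow> 'a set \<Rightarrow> 'a \<Rightarrow> ('a \<Rightarrow> int) \<Rightarrow> bool" where
  "int_expansion R B r c \<longleftrightarrow>
     (\<forall>x. x \<notin> B \<longrightarrow> c x = 0) \<and> r = (\<Oplus>\<^bsub>R\<^esub>x\<in>B. [c x] \<cdot>\<^bsub>R\<^esub> x)"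

text \<open>The coordinate of \<^term>\<open>r\<close> at a basis element; in particular
  \<open>c\<^sub>i\<^sub>j\<^sup>k\<close> is \<open>coeff R B (b\<^sub>i b\<^sub>j) b\<^sub>k\<close>.\<close>

definition coeff :: "('a, 'm) ring_scheme \<Rightarrow> 'a set \<Rightarrow> 'a \<Rightarrow> 'a \<Rightarrow> int" where
  "coeff R B r = (THE c. int_expansion R B r c)"

text \<open>The basis is indexed by itself, so the involution of the index set is a map
  \<open>star\<close> on \<open>B\<close>.\<close>

locale fusion_ring = ring R for R :: "('a, 'm) ring_scheme" (structure) +
  fixes B :: "'a set" and star :: "'a \<Rightarrow> 'a"
  assumes finite_basis: "finite B"
    and basis_subset: "B \<subseteq> carrier R"
    and one_in_basis: "\<one> \<in> B"
    and basis: "r \<in> carrier R \<Longrightarrow> \<exists>!c. int_expansion R B r c"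
    and nonneg: "\<lbrakk>x \<in> B; y \<in> B; z \<in> B\<rbrakk> \<Longrightarrow> 0 \<le> coeff R B (x \<otimes> y) z"
    and star_closed: "x \<in> B \<Longrightarrow> star x \<in> B"
    and star_star: "x \<in> B \<Longrightarrow> star (star x) = x"
    and anti_involution:
      "\<exists>\<tau> \<in> hom (add_monoid R) (add_monoid R).
         (\<forall>x\<in>B. \<tau> x = star x) \<and>
         (\<forall>r\<in>carrier R. \<forall>s\<in>carrier R. \<tau> (r \<otimes> s) = \<tau> s \<otimes> \<tau> r) \<and>
         (\<forall>r\<in>carrier R. \<tau> (\<tau> r) = r)"
    and coeff_one: "\<lbrakk>x \<in> B; y \<in> B\<rbrakk> \<Longrightarrow> coeff R B (x \<otimes> y) \<one> = (if x = star y then 1 else 0)"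

definition inv_group :: "('a, 'm) ring_scheme \<Rightarrow> 'a set \<Rightarrow> ('a \<Rightarrow> 'a) \<Rightarrow> 'a monoid" where
  "inv_group R B star =
     \<lparr>carrier = {x \<in> B. x \<otimes>\<^bsub>R\<^esub> star x = \<one>\<^bsub>R\<^esub> \<and> star x \<otimes>\<^bsub>R\<^esub> x = \<one>\<^bsub>R\<^esub>},
      mult = mult R, one = one R\<rparr>"

definition left_action :: "('a, 'm) ring_scheme \<Rightarrow> 'a set \<Rightarrow> 'a \<Rightarrow> 'a \<Rightarrow> 'a" where
  "left_action R B g = (\<lambda>x\<in>B. g \<otimes>\<^bsub>R\<^esub> x)"

definition basis_orbits :: "('a, 'm) ring_scheme \<Rightarrow> 'a set \<Rightarrow> ('a \<Rightarrow> 'a) \<Rightarrow> 'a set set" where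
  "basis_orbits R B star = orbits (inv_group R B star) B (left_action R B)"

abbreviation noninv :: "('a, 'm) ring_scheme \<Rightarrow> 'a set \<Rightarrow> ('a \<Rightarrow> 'a) \<Rightarrow> 'a set" where
  "noninv R B star \<equiv> B - carrier (inv_group R B star)"

text \<open>If there are exactly two orbits, then \<open>noninv R B star\<close> is non-empty and closed under the
  involution, hence a single orbit for left and for right multiplication by invertible elements.
  The left stabilizers of \<open>x\<close> and \<open>x g\<close> agree, so the description below has a unique solution,
  and it is normal.\<close>

definition stab_group :: "('a, 'm) ring_scheme \<Rightarrow> 'a set \<Rightarrow> ('a \<Rightarrow> 'a) \<Rightarrow> 'a set" where
  "stab_group R B star =
     (THE H. \<forall>x \<in> noninv R B star. stabilizer (inv_group R B star) (left_action R B) x = H)"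

section \<open>Finite-dimensional complex representations\<close>

text \<open>A pair \<open>(n, \<rho>)\<close> is a representation on \<open>\<complex>\<^sup>n\<close>; the values of \<open>\<rho>\<close> outside the
  carrier of the represented structure are irrelevant.\<close>

type_synonym 'a mrep = "nat \<times> ('a \<Rightarrow> complex mat)"

definition group_rep :: "('a, 'm) monoid_scheme \<Rightarrow> 'a mrep \<Rightarrow> bool" where
  "group_rep G \<rho> \<longleftrightarrow> snd \<rho> \<in> hom G (units_of (ring_mat TYPE(complex) (fst \<rho>) ()))"

definition algebra_rep :: "(complex, 'a, 'm) module_scheme \<Rightarrow> 'a mrep \<Rightarrow> bool" where
  "algebra_rep A \<rho> \<longleftrightarrow>
     snd \<rho> \<in> Ring.ring_hom A (ring_mat TYPE(complex) (fst \<rho>) ()) \<and>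
     (\<forall>c. \<forall>a\<in>carrier A. snd \<rho> (c \<odot>\<^bsub>A\<^esub> a) = c \<cdot>\<^sub>m snd \<rho> a)"

definition irreducible_on :: "'a set \<Rightarrow> 'a mrep \<Rightarrow> bool" where
  "irreducible_on S \<rho> \<longleftrightarrow>
     fst \<rho> \<noteq> 0 \<and>
     (\<forall>W. VectorSpace.subspace class_ring W (module_vec TYPE(complex) (fst \<rho>)) \<and>
          (\<forall>s\<in>S. \<forall>w\<in>W. snd \<rho> s *\<^sub>v w \<in> W)
        \<longrightarrow> W = {0\<^sub>v (fst \<rho>)} \<or> W = carrier_vec (fst \<rho>))"

definition rep_iso_on :: "'a set \<Rightarrow> 'a mrep \<Rightarrow> 'a mrep \<Rightarrow> bool" where
  "rep_iso_on S \<rho> \<sigma> \<longleftrightarrow>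
     fst \<rho> = fst \<sigma> \<and> (\<exists>P Q. \<forall>s\<in>S. similar_mat_wit (snd \<rho> s) (snd \<sigma> s) P Q)"

definition iso_classes :: "'a set \<Rightarrow> 'a mrep set \<Rightarrow> 'a mrep set set" where
  "iso_classes S X = X // {(\<rho>, \<sigma>). \<rho> \<in> X \<and> \<sigma> \<in> X \<and> rep_iso_on S \<rho> \<sigma>}"

definition Irr_group :: "('a, 'm) monoid_scheme \<Rightarrow> 'a mrep set set" where
  "Irr_group G =
     iso_classes (carrier G) {\<rho>. group_rep G \<rho> \<and> irreducible_on (carrier G) \<rho>}"

definition Irr_algebra :: "(complex, 'a, 'm) module_scheme \<Rightarrow> 'a mrep set set" where
  "Irr_algebra A =
     iso_classes (carrier A) {\<rho>. algebra_rep A \<rho> \<and> irreducible_on (carrier A) \<rho>}"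

definition rep_sum :: "'a mrep list \<Rightarrow> 'a mrep" where
  "rep_sum \<sigma>s = (sum_list (map fst \<sigma>s), \<lambda>h. diag_block_mat (map (\<lambda>\<sigma>. snd \<sigma> h) \<sigma>s))"

definition trivial_rep :: "'a mrep" where
  "trivial_rep = (1, \<lambda>_. 1\<^sub>m 1)"

definition sum_of_nontrivial :: "('a, 'm) monoid_scheme \<Rightarrow> 'a mrep \<Rightarrow> bool" where
  "sum_of_nontrivial H \<rho> \<longleftrightarrow>
     (\<exists>\<sigma>s. (\<forall>\<sigma>\<in>set \<sigma>s. group_rep H \<sigma> \<and> irreducible_on (carrier H) \<sigma> \<and>
                 \<not> rep_iso_on (carrier H) \<sigma> trivial_rep) \<and>
           rep_iso_on (carrier H) \<rho> (rep_sum \<sigma>s))"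

text \<open>The condition is invariant under isomorphism, so it does not matter that it is imposed
  on every representative; the same applies to \<open>Irr_zero\<close>.\<close>

definition Irr_rel :: "('a, 'm) monoid_scheme \<Rightarrow> 'a set \<Rightarrow> 'a mrep set set" where
  "Irr_rel G H = {\<Psi> \<in> Irr_group G. \<forall>\<psi>\<in>\<Psi>. sum_of_nontrivial (G\<lparr>carrier := H\<rparr>) \<psi>}"

section \<open>Complexification\<close>

text \<open>As \<^term>\<open>R\<close> is free over the integers on \<^term>\<open>B\<close>, the algebra \<open>R \<otimes>\<^sub>\<int> \<complex>\<close> is the complex
  vector space with basis \<^term>\<open>B\<close>, realised as functions supported on \<^term>\<open>B\<close>, with
  multiplication extended bilinearly from \<^term>\<open>R\<close>. The canonical map \<open>r \<mapsto> r \<otimes> 1\<close> is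
  \<open>to_complex\<close>.\<close>

definition to_complex :: "('a, 'm) ring_scheme \<Rightarrow> 'a set \<Rightarrow> 'a \<Rightarrow> 'a \<Rightarrow> complex" where
  "to_complex R B r = (\<lambda>z. of_int (coeff R B r z))"

definition complexification ::
    "('a, 'm) ring_scheme \<Rightarrow> 'a set \<Rightarrow> (complex, 'a \<Rightarrow> complex) module" where
  "complexification R B =
     \<lparr>carrier = {f. \<forall>x. x \<notin> B \<longrightarrow> f x = 0},
      mult = (\<lambda>f g z. \<Sum>x\<in>B. \<Sum>y\<in>B. f x * g y * of_int (coeff R B (x \<otimes>\<^bsub>R\<^esub> y) z)),
      one = to_complex R B \<one>\<^bsub>R\<^esub>,
      zero = (\<lambda>_. 0),
      add = (\<lambda>f g z. f z + g z),
      smult = (\<lambda>c f z. c * f z)\<rparr>"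

definition Irr_zero ::
    "('a, 'm) ring_scheme \<Rightarrow> 'a set \<Rightarrow> ('a \<Rightarrow> 'a) \<Rightarrow> ('a \<Rightarrow> complex) mrep set set" where
  "Irr_zero R B star =
     {\<Psi> \<in> Irr_algebra (complexification R B).
        \<forall>\<psi>\<in>\<Psi>. \<forall>x \<in> noninv R B star. snd \<psi> (to_complex R B x) = 0\<^sub>m (fst \<psi>) (fst \<psi>)}"

definition rep_trace :: "'a mrep \<Rightarrow> 'a \<Rightarrow> complex" where
  "rep_trace \<psi> a = sum_list (diag_mat (snd \<psi> a))"

definition codegree_element ::
    "('a, 'm) ring_scheme \<Rightarrow> 'a set \<Rightarrow> ('a \<Rightarrow> 'a) \<Rightarrow> ('a \<Rightarrow> complex) mrep \<Rightarrow> 'a \<Rightarrow> complex" where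
  "codegree_element R B star \<psi> =
     (\<Oplus>\<^bsub>complexification R B\<^esub>x\<in>B.
        rep_trace \<psi> (to_complex R B x) \<odot>\<^bsub>complexification R B\<^esub> to_complex R B (star x))"

definition formal_codegree ::
    "('a, 'm) ring_scheme \<Rightarrow> 'a set \<Rightarrow> ('a \<Rightarrow> 'a) \<Rightarrow> ('a \<Rightarrow> complex) mrep \<Rightarrow> complex" where
  "formal_codegree R B star \<psi> =
     (THE c. snd \<psi> (codegree_element R B star \<psi>) = c \<cdot>\<^sub>m 1\<^sub>m (fst \<psi>))"

end

theory Submission
  imports "Jordan_Normal_Form.Spectral_Radius" Defs
begin

text \<open>Let \<open>G\<close> be the group of invertible basis elements, \<open>X = B - G\<close>, and \<open>H\<close> the common stabilizer of
the elements of \<open>X\<close>. The complexified ring is spanned by \<open>G\<close> and \<open>X\<close>, so an irreducible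
representation that kills \<open>X\<close> is determined by its restriction to \<open>G\<close>, which is again irreducible.
The question is which irreducible representations \<open>\<rho>\<close> of \<open>G\<close>, extended by zero on \<open>X\<close>, are
multiplicative.

A product with one factor in \<open>G\<close> and one in \<open>X\<close> lies in \<open>X\<close> and causes no trouble. For \<open>x\<close>, \<open>y\<close> in
\<open>X\<close> the coefficient of \<open>g \<in> G\<close> in \<open>x y\<close> is \<open>1\<close> if \<open>g y\<^sup>* = x\<close> and \<open>0\<close> otherwise
(\<open>coeff_group_element\<close>). As \<open>X\<close> is a single orbit, the \<open>g\<close> with \<open>g y\<^sup>* = x\<close> form a coset \<open>k H\<close>, so
the extension maps \<open>x y\<close> to \<open>\<rho>(k) (\<Sum>h\<in>H. \<rho>(h))\<close>. Hence the extension is multiplicative as soon as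
\<open>(\<Sum>h\<in>H. \<rho>(h)) = 0\<close> (\<open>algebra_rep_extend_rep\<close>). Conversely, if a representation \<open>\<psi>\<close> kills \<open>X\<close>,
then \<open>0 = \<psi>(x) \<psi>(x\<^sup>*) = (\<Sum>h\<in>H. \<psi>(h))\<close> for any \<open>x \<in> X\<close> (\<open>msum_stabilizer_zero\<close>).

The sum over \<open>H\<close> is the order of \<open>H\<close> times the projection onto the vectors fixed by \<open>H\<close>. By Maschke's
theorem the restriction of \<open>\<rho>\<close> to \<open>H\<close> is a direct sum of irreducible representations, each of which
is either trivial or has no non-zero fixed vector. So the sum vanishes if and only if all these
constituents are non-trivial (\<open>sum_of_nontrivial_iff\<close>), and the bijection follows.

For the formal codegree, let \<open>\<psi>\<close> kill \<open>X\<close> and let \<open>\<rho>\<close> be its restriction to \<open>G\<close>. The element that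
defines the codegree acts through \<open>\<psi>\<close> as the sum of \<open>Tr(\<rho>(g)) \<rho>(g\<inverse>)\<close> over \<open>g \<in> G\<close>. The Schur
orthogonality relations identify this operator with the scalar \<open>|G| / dim \<rho>\<close>
(\<open>sum_character_irreducible\<close>).\<close>

section \<open>Finite sums of matrices\<close>

text \<open>The type of matrices has no zero that is neutral for all sizes, so \<open>sum\<close> does not apply to it. With
the dimensions as parameters, the empty sum is the zero matrix of the intended size.\<close>

definition msum :: "nat \<Rightarrow> nat \<Rightarrow> ('b \<Rightarrow> complex mat) \<Rightarrow> 'b set \<Rightarrow> complex mat" where
  "msum nr nc f S = mat nr nc (\<lambda>(i, j). \<Sum>s\<in>S. f s $$ (i, j))"

lemma msum_carrier [simp]: "msum nr nc f S \<in> carrier_mat nr nc"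
  by (simp add: msum_def)

lemma msum_dim [simp]: "dim_row (msum nr nc f S) = nr" "dim_col (msum nr nc f S) = nc"
  by (simp_all add: msum_def)

lemma msum_index [simp]:
  "\<lbrakk>i < nr; j < nc\<rbrakk> \<Longrightarrow> msum nr nc f S $$ (i, j) = (\<Sum>s\<in>S. f s $$ (i, j))"
  by (simp add: msum_def)

lemma msum_cong: "(\<And>s. s \<in> S \<Longrightarrow> f s = g s) \<Longrightarrow> msum nr nc f S = msum nr nc g S"
  by (auto simp: msum_def intro!: eq_matI sum.cong)

lemma msum_reindex:
  "bij_betw h S T \<Longrightarrow> msum nr nc (\<lambda>s. f (h s)) S = msum nr nc f T"
  by (auto simp: msum_def intro!: eq_matI sum.reindex_bij_betw[of h S T])

lemma mult_msum:
  assumes "A \<in> carrier_mat m nr" "\<And>s. s \<in> S \<Longrightarrow> f s \<in> carrier_mat nr nc"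
  shows "A * msum nr nc f S = msum m nc (\<lambda>s. A * f s) S"
proof (rule eq_matI)
  fix i j assume ij: "i < dim_row (msum m nc (\<lambda>s. A * f s) S)" "j < dim_col (msum m nc (\<lambda>s. A * f s) S)"
  have "(A * msum nr nc f S) $$ (i, j) = (\<Sum>k\<in>{0..<nr}. \<Sum>s\<in>S. A $$ (i, k) * f s $$ (k, j))"
    using ij assms(1) by (auto simp: scalar_prod_def sum_distrib_left intro!: sum.cong)
  also have "\<dots> = (\<Sum>s\<in>S. \<Sum>k\<in>{0..<nr}. A $$ (i, k) * f s $$ (k, j))"
    by (rule sum.swap)
  also have "\<dots> = (\<Sum>s\<in>S. (A * f s) $$ (i, j))"
  proof (rule sum.cong)
    fix s assume "s \<in> S"
    then show "(\<Sum>k\<in>{0..<nr}. A $$ (i, k) * f s $$ (k, j)) = (A * f s) $$ (i, j)"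
      using ij assms(1) assms(2)[of s] by (auto simp: scalar_prod_def intro!: sum.cong)
  qed simp
  finally show "(A * msum nr nc f S) $$ (i, j) = msum m nc (\<lambda>s. A * f s) S $$ (i, j)"
    using ij by simp
qed (use assms in auto)

lemma msum_mult:
  assumes "A \<in> carrier_mat nc m" "\<And>s. s \<in> S \<Longrightarrow> f s \<in> carrier_mat nr nc"
  shows "msum nr nc f S * A = msum nr m (\<lambda>s. f s * A) S"
proof (rule eq_matI)
  fix i j assume ij: "i < dim_row (msum nr m (\<lambda>s. f s * A) S)" "j < dim_col (msum nr m (\<lambda>s. f s * A) S)"
  have "(msum nr nc f S * A) $$ (i, j) = (\<Sum>k\<in>{0..<nc}. \<Sum>s\<in>S. f s $$ (i, k) * A $$ (k, j))"
    using ij assms(1) by (auto simp: scalar_prod_def sum_distrib_right intro!: sum.cong)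
  also have "\<dots> = (\<Sum>s\<in>S. \<Sum>k\<in>{0..<nc}. f s $$ (i, k) * A $$ (k, j))"
    by (rule sum.swap)
  also have "\<dots> = (\<Sum>s\<in>S. (f s * A) $$ (i, j))"
  proof (rule sum.cong)
    fix s assume "s \<in> S"
    then show "(\<Sum>k\<in>{0..<nc}. f s $$ (i, k) * A $$ (k, j)) = (f s * A) $$ (i, j)"
      using ij assms(1) assms(2)[of s] by (auto simp: scalar_prod_def intro!: sum.cong)
  qed simp
  finally show "(msum nr nc f S * A) $$ (i, j) = msum nr m (\<lambda>s. f s * A) S $$ (i, j)"
    using ij by simp
qed (use assms in auto)

lemma msum_insert:
  assumes "finite S" "s \<notin> S" "f s \<in> carrier_mat nr nc"
  shows "msum nr nc f (insert s S) = f s + msum nr nc f S"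
  using assms by (auto intro!: eq_matI)

lemma msum_empty: "msum nr nc f {} = 0\<^sub>m nr nc"
  by (auto intro!: eq_matI)

lemma msum_four_block:
  assumes "\<And>s. s \<in> S \<Longrightarrow> A s \<in> carrier_mat k k" "\<And>s. s \<in> S \<Longrightarrow> D s \<in> carrier_mat m m"
  shows "msum (k + m) (k + m) (\<lambda>s. four_block_mat (A s) (0\<^sub>m k m) (0\<^sub>m m k) (D s)) S =
         four_block_mat (msum k k A S) (0\<^sub>m k m) (0\<^sub>m m k) (msum m m D S)"
proof (rule eq_matI)
  fix i j assume ij: "i < dim_row (four_block_mat (msum k k A S) (0\<^sub>m k m) (0\<^sub>m m k) (msum m m D S))"
    "j < dim_col (four_block_mat (msum k k A S) (0\<^sub>m k m) (0\<^sub>m m k) (msum m m D S))"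
  have "(\<Sum>s\<in>S. four_block_mat (A s) (0\<^sub>m k m) (0\<^sub>m m k) (D s) $$ (i, j)) =
    (\<Sum>s\<in>S. if i < k then if j < k then A s $$ (i, j) else 0
             else if j < k then 0 else D s $$ (i - k, j - k))"
  proof (rule sum.cong)
    fix s assume "s \<in> S"
    then have "A s \<in> carrier_mat k k" "D s \<in> carrier_mat m m" using assms by auto
    then show "four_block_mat (A s) (0\<^sub>m k m) (0\<^sub>m m k) (D s) $$ (i, j) =
      (if i < k then if j < k then A s $$ (i, j) else 0
             else if j < k then 0 else D s $$ (i - k, j - k))"
      using ij by auto
  qed simp
  then show "msum (k + m) (k + m) (\<lambda>s. four_block_mat (A s) (0\<^sub>m k m) (0\<^sub>m m k) (D s)) S $$ (i, j) =
    four_block_mat (msum k k A S) (0\<^sub>m k m) (0\<^sub>m m k) (msum m m D S) $$ (i, j)"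
    using ij by (cases "i < k"; cases "j < k") auto
qed auto

text \<open>Equal block matrices have equal blocks only because the blocks have the same sizes; a block matrix by
itself does not determine where it is divided.\<close>

lemma four_block_inject:
  assumes "four_block_mat A B C D = four_block_mat A' B' C' D'"
    and "A \<in> carrier_mat k k" "B \<in> carrier_mat k m" "C \<in> carrier_mat m k" "D \<in> carrier_mat m m"
    and "A' \<in> carrier_mat k k" "B' \<in> carrier_mat k m" "C' \<in> carrier_mat m k" "D' \<in> carrier_mat m m"
  shows "A = A'" "B = B'" "D = D'"
proof -
  have e: "four_block_mat A B C D $$ (i, j) = four_block_mat A' B' C' D' $$ (i, j)" for i j
    using assms(1) by simp
  show "A = A'"
  proof (rule eq_matI)
    fix i j assume "i < dim_row A'" "j < dim_col A'"
    then show "A $$ (i, j) = A' $$ (i, j)" using e[of i j] assms(2-) by auto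
  qed (use assms in auto)
  show "B = B'"
  proof (rule eq_matI)
    fix i j assume "i < dim_row B'" "j < dim_col B'"
    then show "B $$ (i, j) = B' $$ (i, j)" using e[of i "j + k"] assms(2-) by auto
  qed (use assms in auto)
  show "D = D'"
  proof (rule eq_matI)
    fix i j assume "i < dim_row D'" "j < dim_col D'"
    then show "D $$ (i, j) = D' $$ (i, j)" using e[of "i + k" "j + k"] assms(2-) by auto
  qed (use assms in auto)
qed

lemma index_smult_mat_carrier:
  "\<lbrakk>M \<in> carrier_mat n m; i < n; j < m\<rbrakk> \<Longrightarrow> (c \<cdot>\<^sub>m M) $$ (i, j) = c * M $$ (i, j)"
  by auto

lemma mat_eq_if_mult_vec_eq:
  fixes A B :: "complex mat"
  assumes "A \<in> carrier_mat n m" "B \<in> carrier_mat n m"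
    and "\<And>v. v \<in> carrier_vec m \<Longrightarrow> A *\<^sub>v v = B *\<^sub>v v"
  shows "A = B"
proof (rule eq_matI)
  fix i j assume ij: "i < dim_row B" "j < dim_col B"
  then have "(A *\<^sub>v unit_vec m j) $ i = (B *\<^sub>v unit_vec m j) $ i"
    using assms(3)[of "unit_vec m j"] by simp
  then show "A $$ (i, j) = B $$ (i, j)"
    using ij assms(1,2) by simp
qed (use assms in auto)

lemma smult_mat_mult_vec:
  fixes A :: "complex mat"
  assumes "A \<in> carrier_mat n m" "v \<in> carrier_vec m"
  shows "(c \<cdot>\<^sub>m A) *\<^sub>v v = c \<cdot>\<^sub>v (A *\<^sub>v v)"
  using assms by (intro eq_vecI) auto

section \<open>Matrix representations and invariant subspaces\<close>

abbreviation subspace_of :: "nat \<Rightarrow> complex vec set \<Rightarrow> bool" where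
  "subspace_of n W \<equiv> VectorSpace.subspace class_ring W (module_vec TYPE(complex) n)"

lemma subspace_of_iff:
  "subspace_of n W \<longleftrightarrow> W \<subseteq> carrier_vec n \<and> 0\<^sub>v n \<in> W \<and>
     (\<forall>v\<in>W. \<forall>w\<in>W. v + w \<in> W) \<and> (\<forall>c. \<forall>v\<in>W. c \<cdot>\<^sub>v v \<in> W)"
proof -
  have m: "Module.module (class_ring :: complex ring) (module_vec TYPE(complex) n)"
    by (rule vec_module)
  have v: "vectorspace (class_ring :: complex ring) (module_vec TYPE(complex) n)"
    by (rule vec_vs)
  show ?thesis
    unfolding VectorSpace.subspace_def submodule_def using m v
    by (auto simp: module_vec_simps)
qed

text \<open>Like \<open>msum\<close>, the sum of vectors is formed entrywise, so that the dimension is explicit.\<close>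

lemma subspace_of_sum:
  assumes W: "subspace_of n W" and "finite S" "\<And>s. s \<in> S \<Longrightarrow> f s \<in> W"
  shows "vec n (\<lambda>a. \<Sum>s\<in>S. f s $ a) \<in> W"
  using assms(2,3)
proof (induction S)
  case empty
  have "vec n (\<lambda>a. \<Sum>s\<in>{}. f s $ a) = 0\<^sub>v n" by auto
  then show ?case using W by (simp add: subspace_of_iff)
next
  case (insert s S)
  have "f s \<in> carrier_vec n" using insert W by (auto simp: subspace_of_iff)
  then have "vec n (\<lambda>a. \<Sum>s\<in>insert s S. f s $ a) = f s + vec n (\<lambda>a. \<Sum>s\<in>S. f s $ a)"
    using insert.hyps by auto
  then show ?case using insert W by (simp add: subspace_of_iff)
qed

lemma subspace_of_columns:
  assumes W: "subspace_of n W" and P: "P \<in> carrier_mat n m" and c: "c \<in> carrier_vec m"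
    and cols: "\<And>j. j < m \<Longrightarrow> col P j \<in> W"
  shows "P *\<^sub>v c \<in> W"
proof -
  have "P *\<^sub>v c = vec n (\<lambda>a. \<Sum>j<m. (c $ j \<cdot>\<^sub>v col P j) $ a)"
    using P c by (intro eq_vecI)
      (auto simp: scalar_prod_def lessThan_atLeast0 mult.commute intro!: sum.cong)
  moreover have "c $ j \<cdot>\<^sub>v col P j \<in> W" if "j < m" for j
    using W cols[OF that] by (simp add: subspace_of_iff)
  ultimately show ?thesis using subspace_of_sum[OF W, of "{..<m}"] by simp
qed

text \<open>Once the identity goes to the identity matrix, multiplicativity forces invertibility: the image of the
inverse element is an inverse matrix.\<close>

lemma group_rep_iff:
  assumes "group G"
  shows "group_rep G \<rho> \<longleftrightarrow>
    (\<forall>g\<in>carrier G. snd \<rho> g \<in> carrier_mat (fst \<rho>) (fst \<rho>)) \<and>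
    (\<forall>g\<in>carrier G. \<forall>h\<in>carrier G. snd \<rho> (g \<otimes>\<^bsub>G\<^esub> h) = snd \<rho> g * snd \<rho> h) \<and>
    snd \<rho> \<one>\<^bsub>G\<^esub> = 1\<^sub>m (fst \<rho>)"
proof -
  interpret G: group G by fact
  let ?M = "ring_mat TYPE(complex) (fst \<rho>) ()"
  interpret M: ring ?M by (rule ring_mat)
  have gM: "group (units_of ?M)" by (rule M.units_group)
  show ?thesis
  proof
    assume r: "group_rep G \<rho>"
    then have h: "snd \<rho> \<in> hom G (units_of ?M)" by (simp add: group_rep_def)
    then interpret group_hom G "units_of ?M" "snd \<rho>"
      by (simp add: group_hom_def group_hom_axioms_def gM G.is_group)
    have one: "snd \<rho> \<one>\<^bsub>G\<^esub> = 1\<^sub>m (fst \<rho>)"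
      using hom_one by (simp add: units_of_one ring_mat_simps)
    have "\<And>g. g \<in> carrier G \<Longrightarrow> snd \<rho> g \<in> Units ?M"
      using hom_closed by (simp add: units_of_carrier)
    then have "\<And>g. g \<in> carrier G \<Longrightarrow> snd \<rho> g \<in> carrier_mat (fst \<rho>) (fst \<rho>)"
      using M.Units_closed by (simp add: ring_mat_simps)
    then show "(\<forall>g\<in>carrier G. snd \<rho> g \<in> carrier_mat (fst \<rho>) (fst \<rho>)) \<and>
      (\<forall>g\<in>carrier G. \<forall>h\<in>carrier G. snd \<rho> (g \<otimes>\<^bsub>G\<^esub> h) = snd \<rho> g * snd \<rho> h) \<and>
      snd \<rho> \<one>\<^bsub>G\<^esub> = 1\<^sub>m (fst \<rho>)"
      using one hom_mult by (simp add: units_of_mult ring_mat_simps)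
  next
    assume a: "(\<forall>g\<in>carrier G. snd \<rho> g \<in> carrier_mat (fst \<rho>) (fst \<rho>)) \<and>
      (\<forall>g\<in>carrier G. \<forall>h\<in>carrier G. snd \<rho> (g \<otimes>\<^bsub>G\<^esub> h) = snd \<rho> g * snd \<rho> h) \<and>
      snd \<rho> \<one>\<^bsub>G\<^esub> = 1\<^sub>m (fst \<rho>)"
    have "snd \<rho> g \<in> Units ?M" if g: "g \<in> carrier G" for g
    proof -
      have "snd \<rho> (inv\<^bsub>G\<^esub> g) * snd \<rho> g = 1\<^sub>m (fst \<rho>)" "snd \<rho> g * snd \<rho> (inv\<^bsub>G\<^esub> g) = 1\<^sub>m (fst \<rho>)"
        using a g by (metis G.inv_closed G.l_inv, metis G.inv_closed G.r_inv g a)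
      then show ?thesis using a g G.inv_closed[OF g]
        by (auto simp: Units_def ring_mat_simps)
    qed
    then show "group_rep G \<rho>" using a
      by (auto simp: group_rep_def hom_def units_of_carrier units_of_mult ring_mat_simps)
  qed
qed

lemma group_repD:
  assumes "group G" "group_rep G \<rho>"
  shows group_rep_carrier: "g \<in> carrier G \<Longrightarrow> snd \<rho> g \<in> carrier_mat (fst \<rho>) (fst \<rho>)"
    and group_rep_mult: "\<lbrakk>g \<in> carrier G; h \<in> carrier G\<rbrakk> \<Longrightarrow> snd \<rho> (g \<otimes>\<^bsub>G\<^esub> h) = snd \<rho> g * snd \<rho> h"
    and group_rep_one: "snd \<rho> \<one>\<^bsub>G\<^esub> = 1\<^sub>m (fst \<rho>)"
  using assms by (simp_all add: group_rep_iff)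

lemma group_rep_inv_mult:
  assumes "group G" "group_rep G \<rho>" "g \<in> carrier G"
  shows "snd \<rho> (inv\<^bsub>G\<^esub> g) * snd \<rho> g = 1\<^sub>m (fst \<rho>)" "snd \<rho> g * snd \<rho> (inv\<^bsub>G\<^esub> g) = 1\<^sub>m (fst \<rho>)"
proof -
  interpret group G by fact
  show "snd \<rho> (inv\<^bsub>G\<^esub> g) * snd \<rho> g = 1\<^sub>m (fst \<rho>)" "snd \<rho> g * snd \<rho> (inv\<^bsub>G\<^esub> g) = 1\<^sub>m (fst \<rho>)"
    using assms(3) inv_closed[OF assms(3)] l_inv[OF assms(3)] r_inv[OF assms(3)]
      group_rep_mult[OF assms(1,2)] group_rep_one[OF assms(1,2)] by metis+
qed

text \<open>Left translation permutes a group. This is the substitution behind all averaging arguments below.\<close>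

lemma msum_translate:
  assumes "group G" "g \<in> carrier G"
  shows "msum nr nc (\<lambda>h. f (g \<otimes>\<^bsub>G\<^esub> h)) (carrier G) = msum nr nc f (carrier G)"
proof (rule msum_reindex)
  interpret group G by fact
  show "bij_betw (\<lambda>h. g \<otimes>\<^bsub>G\<^esub> h) (carrier G) (carrier G)"
    using assms(2) by (intro bij_betw_byWitness[where f' = "\<lambda>h. inv\<^bsub>G\<^esub> g \<otimes>\<^bsub>G\<^esub> h"])
      (auto simp: m_assoc[symmetric])
qed

section \<open>Schur's lemma and orthogonality of matrix coefficients\<close>

lemma irreducible_on_cases:
  assumes "irreducible_on S \<rho>" "subspace_of (fst \<rho>) W"
    and "\<And>s w. \<lbrakk>s \<in> S; w \<in> W\<rbrakk> \<Longrightarrow> snd \<rho> s *\<^sub>v w \<in> W"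
  shows "W = {0\<^sub>v (fst \<rho>)} \<or> W = carrier_vec (fst \<rho>)"
  using assms unfolding irreducible_on_def by blast

text \<open>Over the complex numbers a matrix that commutes with the representation has an eigenvalue; its
eigenspace is a non-zero invariant subspace, hence everything.\<close>

lemma Schur_scalar:
  assumes irr: "irreducible_on S \<rho>"
    and car: "\<And>s. s \<in> S \<Longrightarrow> snd \<rho> s \<in> carrier_mat (fst \<rho>) (fst \<rho>)"
    and A: "A \<in> carrier_mat (fst \<rho>) (fst \<rho>)"
    and comm: "\<And>s. s \<in> S \<Longrightarrow> A * snd \<rho> s = snd \<rho> s * A"
  obtains c where "A = c \<cdot>\<^sub>m 1\<^sub>m (fst \<rho>)"
proof -
  let ?n = "fst \<rho>"
  have "?n > 0" using irr by (simp add: irreducible_on_def)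
  then obtain c where "c \<in> spectrum A" using spectrum_non_empty[OF A] by auto
  then obtain v where v: "v \<in> carrier_vec ?n" "v \<noteq> 0\<^sub>v ?n" "A *\<^sub>v v = c \<cdot>\<^sub>v v"
    using A by (auto simp: spectrum_def eigenvalue_def eigenvector_def)
  define W where "W = {w \<in> carrier_vec ?n. A *\<^sub>v w = c \<cdot>\<^sub>v w}"
  have "subspace_of ?n W"
    using A unfolding subspace_of_iff W_def
    by (auto simp: mult_add_distrib_mat_vec smult_add_distrib_vec mult_mat_vec smult_smult_assoc mult.commute)
  moreover have "snd \<rho> s *\<^sub>v w \<in> W" if "s \<in> S" "w \<in> W" for s w
  proof -
    have s: "snd \<rho> s \<in> carrier_mat ?n ?n" using car that by simp
    have w: "w \<in> carrier_vec ?n" "A *\<^sub>v w = c \<cdot>\<^sub>v w" using that by (auto simp: W_def)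
    have "A *\<^sub>v (snd \<rho> s *\<^sub>v w) = (A * snd \<rho> s) *\<^sub>v w"
      using assoc_mult_mat_vec[OF A s w(1)] by simp
    also have "\<dots> = snd \<rho> s *\<^sub>v (A *\<^sub>v w)"
      using assoc_mult_mat_vec[OF s A w(1)] comm[OF that(1)] by simp
    also have "\<dots> = c \<cdot>\<^sub>v (snd \<rho> s *\<^sub>v w)"
      using mult_mat_vec[OF s w(1)] w by simp
    finally show ?thesis using s w by (auto simp: W_def)
  qed
  moreover have "W \<noteq> {0\<^sub>v ?n}" using v by (auto simp: W_def)
  ultimately have W: "W = carrier_vec ?n" using irreducible_on_cases[OF irr] by blast
  have "A = c \<cdot>\<^sub>m 1\<^sub>m ?n"
  proof (rule mat_eq_if_mult_vec_eq[OF A])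
    fix w :: "complex vec" assume "w \<in> carrier_vec ?n"
    then show "A *\<^sub>v w = (c \<cdot>\<^sub>m 1\<^sub>m ?n) *\<^sub>v w"
      using W by (auto simp: W_def smult_mat_mult_vec[OF one_carrier_mat])
  qed simp
  then show ?thesis by (rule that)
qed


definition tr :: "complex mat \<Rightarrow> complex" where
  "tr A = (\<Sum>i<dim_row A. A $$ (i, i))"

lemma tr_mult_commute:
  assumes "A \<in> carrier_mat n m" "B \<in> carrier_mat m n"
  shows "tr (A * B) = tr (B * A)"
proof -
  have "tr (A * B) = (\<Sum>i<n. \<Sum>j<m. A $$ (i, j) * B $$ (j, i))"
    using assms by (auto simp: tr_def scalar_prod_def lessThan_atLeast0 intro!: sum.cong)
  also have "\<dots> = (\<Sum>j<m. \<Sum>i<n. A $$ (i, j) * B $$ (j, i))"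
    by (rule sum.swap)
  also have "\<dots> = tr (B * A)"
    using assms by (auto simp: tr_def scalar_prod_def lessThan_atLeast0 mult.commute intro!: sum.cong)
  finally show ?thesis .
qed

text \<open>Up to the factor \<open>|G|\<close> this is the projection of the matrix space onto the matrices that commute with
the representation.\<close>

definition average :: "('a, 'm) monoid_scheme \<Rightarrow> 'a mrep \<Rightarrow> complex mat \<Rightarrow> complex mat" where
  "average G \<rho> E = msum (fst \<rho>) (fst \<rho>) (\<lambda>g. snd \<rho> g * E * snd \<rho> (inv\<^bsub>G\<^esub> g)) (carrier G)"

lemma average_commutes:
  assumes G: "group G" and \<rho>: "group_rep G \<rho>"
    and E: "E \<in> carrier_mat (fst \<rho>) (fst \<rho>)" and h: "h \<in> carrier G"
  shows "average G \<rho> E * snd \<rho> h = snd \<rho> h * average G \<rho> E"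
proof -
  interpret group G by fact
  let ?n = "fst \<rho>"
  have car: "\<And>g. g \<in> carrier G \<Longrightarrow> snd \<rho> g \<in> carrier_mat ?n ?n"
    using group_rep_carrier[OF G \<rho>] .
  have car3: "\<And>g. g \<in> carrier G \<Longrightarrow> snd \<rho> g * E * snd \<rho> (inv\<^bsub>G\<^esub> g) \<in> carrier_mat ?n ?n"
    using car E by (meson inv_closed mult_carrier_mat)
  have "average G \<rho> E * snd \<rho> h
      = msum ?n ?n (\<lambda>g. snd \<rho> g * E * snd \<rho> (inv\<^bsub>G\<^esub> g) * snd \<rho> h) (carrier G)"
    unfolding average_def by (intro msum_mult car car3 h)
  also have "\<dots> = msum ?n ?n (\<lambda>g. snd \<rho> (h \<otimes>\<^bsub>G\<^esub> g) * E * snd \<rho> (inv\<^bsub>G\<^esub> (h \<otimes>\<^bsub>G\<^esub> g)) * snd \<rho> h) (carrier G)"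
    by (rule msum_translate[OF G h, symmetric])
  also have "\<dots> = msum ?n ?n (\<lambda>g. snd \<rho> h * (snd \<rho> g * E * snd \<rho> (inv\<^bsub>G\<^esub> g))) (carrier G)"
  proof (rule msum_cong)
    fix g assume g: "g \<in> carrier G"
    have *: "snd \<rho> (inv\<^bsub>G\<^esub> (h \<otimes>\<^bsub>G\<^esub> g)) * snd \<rho> h = snd \<rho> (inv\<^bsub>G\<^esub> g)"
      using group_rep_mult[OF G \<rho>, of "inv\<^bsub>G\<^esub> (h \<otimes>\<^bsub>G\<^esub> g)" h] g h
      by (simp add: inv_mult_group m_assoc)
    have "snd \<rho> (h \<otimes>\<^bsub>G\<^esub> g) * E * snd \<rho> (inv\<^bsub>G\<^esub> (h \<otimes>\<^bsub>G\<^esub> g)) * snd \<rho> h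
        = snd \<rho> (h \<otimes>\<^bsub>G\<^esub> g) * E * (snd \<rho> (inv\<^bsub>G\<^esub> (h \<otimes>\<^bsub>G\<^esub> g)) * snd \<rho> h)"
      using g h by (intro assoc_mult_mat[of _ ?n ?n _ ?n _ ?n] mult_carrier_mat[of _ _ ?n] car E) auto
    also have "\<dots> = snd \<rho> h * snd \<rho> g * E * snd \<rho> (inv\<^bsub>G\<^esub> g)"
      unfolding * using group_rep_mult[OF G \<rho>] g h by simp
    also have "\<dots> = snd \<rho> h * (snd \<rho> g * E * snd \<rho> (inv\<^bsub>G\<^esub> g))"
      using car[OF g] car[OF h] car[of "inv\<^bsub>G\<^esub> g"] g E
      by (simp add: assoc_mult_mat[of _ ?n ?n _ ?n _ ?n])
    finally show "snd \<rho> (h \<otimes>\<^bsub>G\<^esub> g) * E * snd \<rho> (inv\<^bsub>G\<^esub> (h \<otimes>\<^bsub>G\<^esub> g)) * snd \<rho> h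
        = snd \<rho> h * (snd \<rho> g * E * snd \<rho> (inv\<^bsub>G\<^esub> g))" .
  qed
  also have "\<dots> = snd \<rho> h * average G \<rho> E"
    unfolding average_def by (intro mult_msum[symmetric] car car3 h)
  finally show ?thesis .
qed

text \<open>By Schur's lemma the average is a scalar; conjugation preserves the trace, so the trace of the average
is \<open>|G|\<close> times the trace of \<open>E\<close>, which determines the scalar.\<close>

lemma average_irreducible:
  assumes G: "group G" and \<rho>: "group_rep G \<rho>" and irr: "irreducible_on (carrier G) \<rho>"
    and E: "E \<in> carrier_mat (fst \<rho>) (fst \<rho>)"
  shows "average G \<rho> E = (of_nat (Coset.order G) * tr E / of_nat (fst \<rho>)) \<cdot>\<^sub>m 1\<^sub>m (fst \<rho>)"
proof -
  interpret group G by fact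
  let ?n = "fst \<rho>"
  have car: "\<And>g. g \<in> carrier G \<Longrightarrow> snd \<rho> g \<in> carrier_mat ?n ?n"
    using group_rep_carrier[OF G \<rho>] .
  have n: "?n \<noteq> 0" using irr by (simp add: irreducible_on_def)
  have "average G \<rho> E \<in> carrier_mat ?n ?n" by (simp add: average_def)
  then obtain c where c: "average G \<rho> E = c \<cdot>\<^sub>m 1\<^sub>m ?n"
    using Schur_scalar[OF irr car _ average_commutes[OF G \<rho> E]] by blast
  have "of_nat ?n * c = tr (average G \<rho> E)"
    by (simp add: c tr_def)
  also have "\<dots> = (\<Sum>i<?n. \<Sum>g\<in>carrier G. (snd \<rho> g * E * snd \<rho> (inv\<^bsub>G\<^esub> g)) $$ (i, i))"
    by (simp add: average_def tr_def)
  also have "\<dots> = (\<Sum>g\<in>carrier G. \<Sum>i<?n. (snd \<rho> g * E * snd \<rho> (inv\<^bsub>G\<^esub> g)) $$ (i, i))"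
    by (rule sum.swap)
  also have "\<dots> = (\<Sum>g\<in>carrier G. tr E)"
  proof (rule sum.cong)
    fix g assume g: "g \<in> carrier G"
    have cg: "snd \<rho> g \<in> carrier_mat ?n ?n" "snd \<rho> (inv\<^bsub>G\<^esub> g) \<in> carrier_mat ?n ?n"
      using car g by auto
    have "(\<Sum>i<?n. (snd \<rho> g * E * snd \<rho> (inv\<^bsub>G\<^esub> g)) $$ (i, i)) = tr (snd \<rho> g * E * snd \<rho> (inv\<^bsub>G\<^esub> g))"
      using cg by (simp add: tr_def)
    also have "\<dots> = tr (snd \<rho> (inv\<^bsub>G\<^esub> g) * (snd \<rho> g * E))"
      using cg E by (intro tr_mult_commute[of _ ?n ?n]) auto
    also have "snd \<rho> (inv\<^bsub>G\<^esub> g) * (snd \<rho> g * E) = E"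
      using group_rep_inv_mult[OF G \<rho> g] cg E assoc_mult_mat[OF cg(2) cg(1) E] by simp
    finally show "(\<Sum>i<?n. (snd \<rho> g * E * snd \<rho> (inv\<^bsub>G\<^esub> g)) $$ (i, i)) = tr E" .
  qed simp
  finally have "of_nat ?n * c = of_nat (Coset.order G) * tr E" by (simp add: Coset.order_def)
  then have "c = of_nat (Coset.order G) * tr E / of_nat ?n"
    using n by (simp add: field_simps)
  then show ?thesis using c by simp
qed

definition unit_mat :: "nat \<Rightarrow> nat \<Rightarrow> nat \<Rightarrow> complex mat" where
  "unit_mat n i j = mat n n (\<lambda>(a, b). if a = i \<and> b = j then 1 else 0)"

lemma unit_mat_carrier: "unit_mat n i j \<in> carrier_mat n n"
  by (simp add: unit_mat_def)

text \<open>A matrix unit between two matrices isolates a product of two of their coefficients. Sums of such products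
are the subject of the orthogonality relations.\<close>

lemma sandwich_unit_mat:
  assumes "A \<in> carrier_mat n n" "B \<in> carrier_mat n n" "i < n" "l < n" "k < n" "m < n"
  shows "(A * unit_mat n i l * B) $$ (k, m) = A $$ (k, i) * B $$ (l, m)"
proof -
  have *: "(A * unit_mat n i l) $$ (k, b) = (if b = l then A $$ (k, i) else 0)" if "b < n" for b
    using assms that by (auto simp: unit_mat_def scalar_prod_def if_distrib cong: if_cong)
  have "(A * unit_mat n i l * B) $$ (k, m) = (\<Sum>b\<in>{0..<n}. (A * unit_mat n i l) $$ (k, b) * B $$ (b, m))"
    using assms by (auto simp: scalar_prod_def unit_mat_def intro!: sum.cong)
  also have "\<dots> = (\<Sum>b\<in>{0..<n}. if b = l then A $$ (k, i) * B $$ (b, m) else 0)"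
    by (rule sum.cong) (auto simp: *)
  also have "\<dots> = A $$ (k, i) * B $$ (l, m)" using assms by simp
  finally show ?thesis .
qed

lemma tr_unit_mat: "\<lbrakk>i < n; l < n\<rbrakk> \<Longrightarrow> tr (unit_mat n i l) = (if i = l then 1 else 0)"
  by (auto simp: tr_def unit_mat_def if_distrib cong: if_cong)

text \<open>The entries of the average of a matrix unit are sums of products of two matrix coefficients.\<close>

lemma Schur_orthogonality:
  assumes G: "group G" and \<rho>: "group_rep G \<rho>" and irr: "irreducible_on (carrier G) \<rho>"
    and less: "i < fst \<rho>" "l < fst \<rho>" "k < fst \<rho>" "m < fst \<rho>"
  shows "(\<Sum>g\<in>carrier G. snd \<rho> g $$ (k, i) * snd \<rho> (inv\<^bsub>G\<^esub> g) $$ (l, m)) =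
    (if i = l \<and> k = m then of_nat (Coset.order G) / of_nat (fst \<rho>) else 0)"
proof -
  interpret group G by fact
  have "(\<Sum>g\<in>carrier G. snd \<rho> g $$ (k, i) * snd \<rho> (inv\<^bsub>G\<^esub> g) $$ (l, m))
      = average G \<rho> (unit_mat (fst \<rho>) i l) $$ (k, m)"
    unfolding average_def using less group_rep_carrier[OF G \<rho>]
    by (auto simp: sandwich_unit_mat intro!: sum.cong)
  also have "\<dots> = (if i = l \<and> k = m then of_nat (Coset.order G) / of_nat (fst \<rho>) else 0)"
    using less by (subst average_irreducible[OF G \<rho> irr unit_mat_carrier]) (auto simp: tr_unit_mat)
  finally show ?thesis .
qed

text \<open>The trace is the sum of the diagonal coefficients; the orthogonality relations leave one term of the
resulting double sum in each diagonal entry and none elsewhere.\<close>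

lemma sum_character_irreducible:
  assumes G: "group G" and \<rho>: "group_rep G \<rho>" and irr: "irreducible_on (carrier G) \<rho>"
  shows "msum (fst \<rho>) (fst \<rho>) (\<lambda>g. tr (snd \<rho> g) \<cdot>\<^sub>m snd \<rho> (inv\<^bsub>G\<^esub> g)) (carrier G) =
    (of_nat (Coset.order G) / of_nat (fst \<rho>)) \<cdot>\<^sub>m 1\<^sub>m (fst \<rho>)" (is "?L = ?R")
proof (rule eq_matI)
  interpret group G by fact
  fix l m assume "l < dim_row ?R" "m < dim_col ?R"
  then have lm: "l < fst \<rho>" "m < fst \<rho>" by auto
  have "?L $$ (l, m) = (\<Sum>g\<in>carrier G. \<Sum>i<fst \<rho>. snd \<rho> g $$ (i, i) * snd \<rho> (inv\<^bsub>G\<^esub> g) $$ (l, m))"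
    unfolding msum_index[OF lm]
  proof (rule sum.cong)
    fix g assume "g \<in> carrier G"
    then have "snd \<rho> g \<in> carrier_mat (fst \<rho>) (fst \<rho>)" "snd \<rho> (inv\<^bsub>G\<^esub> g) \<in> carrier_mat (fst \<rho>) (fst \<rho>)"
      using group_rep_carrier[OF G \<rho>] by auto
    then show "(tr (snd \<rho> g) \<cdot>\<^sub>m snd \<rho> (inv\<^bsub>G\<^esub> g)) $$ (l, m) =
      (\<Sum>i<fst \<rho>. snd \<rho> g $$ (i, i) * snd \<rho> (inv\<^bsub>G\<^esub> g) $$ (l, m))"
      using lm by (simp add: tr_def sum_distrib_right)
  qed simp
  also have "\<dots> = (\<Sum>i<fst \<rho>. \<Sum>g\<in>carrier G. snd \<rho> g $$ (i, i) * snd \<rho> (inv\<^bsub>G\<^esub> g) $$ (l, m))"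
    by (rule sum.swap)
  also have "\<dots> = (\<Sum>i<fst \<rho>. if i = l \<and> i = m then of_nat (Coset.order G) / of_nat (fst \<rho>) else 0)"
    by (rule sum.cong) (auto simp: Schur_orthogonality[OF G \<rho> irr] lm)
  also have "\<dots> = ?R $$ (l, m)"
    using lm by (cases "l = m") (auto intro!: sum.neutral)
  finally show "?L $$ (l, m) = ?R $$ (l, m)" .
qed auto

section \<open>Isomorphisms and direct sums of representations\<close>

text \<open>An intertwining relation \<open>\<rho> P = P \<sigma>\<close> is easier to check than the form
\<open>\<rho> = P \<sigma> Q\<close>, as it needs no reassociation of threefold products.\<close>

lemma rep_iso_onI:
  assumes "fst \<rho> = fst \<sigma>" "P * Q = 1\<^sub>m (fst \<rho>)" "Q * P = 1\<^sub>m (fst \<rho>)"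
    "P \<in> carrier_mat (fst \<rho>) (fst \<rho>)" "Q \<in> carrier_mat (fst \<rho>) (fst \<rho>)"
    and "\<And>s. s \<in> S \<Longrightarrow> snd \<rho> s \<in> carrier_mat (fst \<rho>) (fst \<rho>)"
    and "\<And>s. s \<in> S \<Longrightarrow> snd \<sigma> s \<in> carrier_mat (fst \<rho>) (fst \<rho>)"
    and "\<And>s. s \<in> S \<Longrightarrow> snd \<rho> s * P = P * snd \<sigma> s"
  shows "rep_iso_on S \<rho> \<sigma>"
proof -
  have "similar_mat_wit (snd \<rho> s) (snd \<sigma> s) P Q" if s: "s \<in> S" for s
  proof (rule similar_mat_witI[of _ _ "fst \<rho>"])
    have "snd \<rho> s = snd \<rho> s * (P * Q)" using assms(2) assms(6)[OF s] by simp
    also have "\<dots> = P * snd \<sigma> s * Q"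
      using assoc_mult_mat[OF assms(6)[OF s] assms(4,5)] assms(8)[OF s] by simp
    finally show "snd \<rho> s = P * snd \<sigma> s * Q" .
  qed (use assms s in auto)
  then show ?thesis using assms(1) unfolding rep_iso_on_def by blast
qed

lemma rep_iso_on_refl:
  "(\<And>s. s \<in> S \<Longrightarrow> snd \<rho> s \<in> carrier_mat (fst \<rho>) (fst \<rho>)) \<Longrightarrow> rep_iso_on S \<rho> \<rho>"
  unfolding rep_iso_on_def using similar_mat_wit_refl by blast

lemma rep_iso_on_sym: "rep_iso_on S \<rho> \<sigma> \<Longrightarrow> rep_iso_on S \<sigma> \<rho>"
  unfolding rep_iso_on_def using similar_mat_wit_sym by metis

lemma rep_iso_on_trans:
  "\<lbrakk>rep_iso_on S \<rho> \<sigma>; rep_iso_on S \<sigma> \<tau>\<rbrakk> \<Longrightarrow> rep_iso_on S \<rho> \<tau>"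
  unfolding rep_iso_on_def using similar_mat_wit_trans by metis

lemma equiv_rep_iso_on:
  assumes "\<And>\<rho> s. \<lbrakk>\<rho> \<in> Y; s \<in> S\<rbrakk> \<Longrightarrow> snd \<rho> s \<in> carrier_mat (fst \<rho>) (fst \<rho>)"
  shows "equiv Y {(\<rho>, \<sigma>). \<rho> \<in> Y \<and> \<sigma> \<in> Y \<and> rep_iso_on S \<rho> \<sigma>}"
proof (rule equivI)
  show "refl_on Y {(\<rho>, \<sigma>). \<rho> \<in> Y \<and> \<sigma> \<in> Y \<and> rep_iso_on S \<rho> \<sigma>}"
    using assms by (auto simp: refl_on_def intro: rep_iso_on_refl)
  show "sym {(\<rho>, \<sigma>). \<rho> \<in> Y \<and> \<sigma> \<in> Y \<and> rep_iso_on S \<rho> \<sigma>}"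
    by (auto simp: sym_def intro: rep_iso_on_sym)
  show "trans {(\<rho>, \<sigma>). \<rho> \<in> Y \<and> \<sigma> \<in> Y \<and> rep_iso_on S \<rho> \<sigma>}"
    by (auto simp: trans_def intro: rep_iso_on_trans)
qed auto

lemma rep_iso_on_zero:
  assumes "rep_iso_on S \<rho> \<sigma>" "s \<in> S" "snd \<rho> s = 0\<^sub>m (fst \<rho>) (fst \<rho>)"
  shows "snd \<sigma> s = 0\<^sub>m (fst \<sigma>) (fst \<sigma>)"
proof -
  obtain P Q where "similar_mat_wit (snd \<rho> s) (snd \<sigma> s) P Q"
    using assms by (auto simp: rep_iso_on_def)
  then have w: "similar_mat_wit (snd \<sigma> s) (snd \<rho> s) Q P" by (rule similar_mat_wit_sym)
  have n: "fst \<sigma> = fst \<rho>" using assms(1) by (simp add: rep_iso_on_def)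
  have "snd \<rho> s \<in> carrier_mat (fst \<rho>) (fst \<rho>)" by (simp add: assms(3))
  note D = similar_mat_witD2[OF this similar_mat_wit_sym[OF w]]
  have "snd \<sigma> s = Q * 0\<^sub>m (fst \<rho>) (fst \<rho>) * P"
    using similar_mat_witD2(3)[OF D(5) w] unfolding assms(3) .
  also have "\<dots> = 0\<^sub>m (fst \<rho>) (fst \<rho>)" using D(6,7) by simp
  finally show ?thesis by (simp add: n)
qed

text \<open>Simultaneous conjugation commutes with sums.\<close>

lemma msum_similar:
  assumes "\<And>s. s \<in> S \<Longrightarrow> similar_mat_wit (A s) (B s) P Q"
    and A: "\<And>s. s \<in> S \<Longrightarrow> A s \<in> carrier_mat n n"
    and zero: "msum n n B S = 0\<^sub>m n n"
  shows "msum n n A S = 0\<^sub>m n n"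
proof (cases "S = {}")
  case True
  then show ?thesis by (simp add: msum_empty)
next
  case False
  note w = similar_mat_witD2[OF A assms(1)]
  have PQ: "P \<in> carrier_mat n n" "Q \<in> carrier_mat n n" using w False by auto
  have "msum n n A S = msum n n (\<lambda>s. P * B s * Q) S" using w(3) by (intro msum_cong) auto
  also have "\<dots> = msum n n (\<lambda>s. P * B s) S * Q"
    using w(5) PQ by (intro msum_mult[symmetric]) (auto intro: mult_carrier_mat[of _ _ n])
  also have "\<dots> = P * msum n n B S * Q"
    using w(5) PQ by (subst mult_msum[of P n n S B n]) auto
  also have "\<dots> = 0\<^sub>m n n" using PQ by (simp add: zero)
  finally show ?thesis .
qed

lemma rep_iso_on_msum_zero:
  assumes "rep_iso_on S \<rho> \<sigma>" "\<And>s. s \<in> S \<Longrightarrow> snd \<rho> s \<in> carrier_mat (fst \<rho>) (fst \<rho>)"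
    and "msum (fst \<sigma>) (fst \<sigma>) (snd \<sigma>) S = 0\<^sub>m (fst \<sigma>) (fst \<sigma>)"
  shows "msum (fst \<rho>) (fst \<rho>) (snd \<rho>) S = 0\<^sub>m (fst \<rho>) (fst \<rho>)"
  using assms msum_similar[of S "snd \<rho>" "snd \<sigma>"] unfolding rep_iso_on_def by metis

lemma rep_sum_Nil: "fst (rep_sum []) = 0" "snd (rep_sum []) h = 0\<^sub>m 0 0"
  by (simp_all add: rep_sum_def)

lemma fst_rep_sum_append [simp]: "fst (rep_sum (xs @ ys)) = fst (rep_sum xs) + fst (rep_sum ys)"
  by (simp add: rep_sum_def)

lemma fst_rep_sum_Cons [simp]: "fst (rep_sum (x # ys)) = fst x + fst (rep_sum ys)"
  by (simp add: rep_sum_def)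

lemma rep_sum_single: "rep_sum [\<sigma>] = \<sigma>"
  by (simp add: rep_sum_def prod_eq_iff fun_eq_iff del: diag_block_mat.simps)

lemma rep_sum_carrier:
  assumes "\<And>\<sigma>. \<sigma> \<in> set \<sigma>s \<Longrightarrow> snd \<sigma> h \<in> carrier_mat (fst \<sigma>) (fst \<sigma>)"
  shows "snd (rep_sum \<sigma>s) h \<in> carrier_mat (fst (rep_sum \<sigma>s)) (fst (rep_sum \<sigma>s))"
proof -
  have "map (\<lambda>\<sigma>. dim_row (snd \<sigma> h)) \<sigma>s = map fst \<sigma>s" "map (\<lambda>\<sigma>. dim_col (snd \<sigma> h)) \<sigma>s = map fst \<sigma>s"
    using assms by auto
  then have "sum_list (map (\<lambda>\<sigma>. dim_row (snd \<sigma> h)) \<sigma>s) = sum_list (map fst \<sigma>s)"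
    "sum_list (map (\<lambda>\<sigma>. dim_col (snd \<sigma> h)) \<sigma>s) = sum_list (map fst \<sigma>s)"
    by (simp_all only:)
  then show ?thesis
    by (auto simp: rep_sum_def dim_diag_block_mat o_def intro!: carrier_matI)
qed

lemma rep_sum_append:
  assumes "\<And>\<sigma>. \<sigma> \<in> set xs \<union> set ys \<Longrightarrow> snd \<sigma> h \<in> carrier_mat (fst \<sigma>) (fst \<sigma>)"
  shows "snd (rep_sum (xs @ ys)) h =
    four_block_mat (snd (rep_sum xs) h) (0\<^sub>m (fst (rep_sum xs)) (fst (rep_sum ys)))
      (0\<^sub>m (fst (rep_sum ys)) (fst (rep_sum xs))) (snd (rep_sum ys) h)"
proof -
  have "snd (rep_sum xs) h \<in> carrier_mat (fst (rep_sum xs)) (fst (rep_sum xs))"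
    "snd (rep_sum ys) h \<in> carrier_mat (fst (rep_sum ys)) (fst (rep_sum ys))"
    using assms by (auto intro: rep_sum_carrier)
  then have "dim_row (snd (rep_sum xs) h) = fst (rep_sum xs)" "dim_col (snd (rep_sum xs) h) = fst (rep_sum xs)"
    "dim_row (snd (rep_sum ys) h) = fst (rep_sum ys)" "dim_col (snd (rep_sum ys) h) = fst (rep_sum ys)"
    by auto
  then show ?thesis
    by (simp add: rep_sum_def diag_block_mat_append Let_def)
qed

lemma rep_iso_on_rep_sum_append:
  assumes 1: "rep_iso_on S \<alpha> (rep_sum xs)" and 2: "rep_iso_on S \<delta> (rep_sum ys)"
    and \<alpha>: "\<And>s. s \<in> S \<Longrightarrow> snd \<alpha> s \<in> carrier_mat (fst \<alpha>) (fst \<alpha>)"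
    and \<delta>: "\<And>s. s \<in> S \<Longrightarrow> snd \<delta> s \<in> carrier_mat (fst \<delta>) (fst \<delta>)"
    and xs: "\<And>s \<sigma>. \<lbrakk>s \<in> S; \<sigma> \<in> set xs \<union> set ys\<rbrakk> \<Longrightarrow> snd \<sigma> s \<in> carrier_mat (fst \<sigma>) (fst \<sigma>)"
  shows "rep_iso_on S (rep_sum [\<alpha>, \<delta>]) (rep_sum (xs @ ys))"
proof -
  let ?k = "fst \<alpha>" and ?m = "fst \<delta>"
  have f: "fst (rep_sum xs) = ?k" "fst (rep_sum ys) = ?m" using 1 2 by (auto simp: rep_iso_on_def)
  obtain P1 Q1 where w1: "\<And>s. s \<in> S \<Longrightarrow> similar_mat_wit (snd \<alpha> s) (snd (rep_sum xs) s) P1 Q1"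
    using 1 by (auto simp: rep_iso_on_def)
  obtain P2 Q2 where w2: "\<And>s. s \<in> S \<Longrightarrow> similar_mat_wit (snd \<delta> s) (snd (rep_sum ys) s) P2 Q2"
    using 2 by (auto simp: rep_iso_on_def)
  have "similar_mat_wit (snd (rep_sum [\<alpha>, \<delta>]) s) (snd (rep_sum (xs @ ys)) s)
     (four_block_mat P1 (0\<^sub>m ?k ?m) (0\<^sub>m ?m ?k) P2) (four_block_mat Q1 (0\<^sub>m ?k ?m) (0\<^sub>m ?m ?k) Q2)"
    if s: "s \<in> S" for s
  proof -
    note c1 = similar_mat_witD2[OF \<alpha>[OF s] w1[OF s]] and c2 = similar_mat_witD2[OF \<delta>[OF s] w2[OF s]]
    have l: "snd (rep_sum [\<alpha>, \<delta>]) s = four_block_mat (snd \<alpha> s) (0\<^sub>m ?k ?m) (0\<^sub>m ?m ?k) (snd \<delta> s)"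
      using rep_sum_append[of "[\<alpha>]" "[\<delta>]" s] \<alpha>[OF s] \<delta>[OF s] by (auto simp: rep_sum_single)
    have r: "snd (rep_sum (xs @ ys)) s =
      four_block_mat (snd (rep_sum xs) s) (0\<^sub>m ?k ?m) (0\<^sub>m ?m ?k) (snd (rep_sum ys) s)"
      using rep_sum_append[of xs ys s] xs[OF s] f by simp
    show ?thesis unfolding l r
      by (rule similar_mat_wit_four_block[OF w1[OF s] w2[OF s]])
        (use c1 c2 \<alpha>[OF s] \<delta>[OF s] in auto)
  qed
  then show ?thesis unfolding rep_iso_on_def using f by (auto simp: rep_sum_Nil)
qed

section \<open>Maschke's theorem\<close>

text \<open>A basis of \<open>W\<close> extended to a basis of the whole space, as the columns of \<open>P\<close>. It is
obtained from an invertible \<open>P\<close> with the largest possible number \<open>k\<close> of leading columns in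
\<open>W\<close>: if some \<open>w \<in> W\<close> had a non-zero coordinate \<open>i \<ge> k\<close> with respect to the columns
of \<open>P\<close>, then by Cramer's rule column \<open>i\<close> could be exchanged for \<open>w\<close> without losing
invertibility, and moving it to position \<open>k\<close> would contradict maximality.\<close>

lemma adapted_basis:
  assumes W: "subspace_of n W" "W \<noteq> {0\<^sub>v n}" "W \<noteq> carrier_vec n"
  obtains k P Q where "0 < k" "k < n" "P \<in> carrier_mat n n" "Q \<in> carrier_mat n n"
    "P * Q = 1\<^sub>m n" "Q * P = 1\<^sub>m n" "\<And>j. j < k \<Longrightarrow> col P j \<in> W"
    "\<And>w i. \<lbrakk>w \<in> W; k \<le> i; i < n\<rbrakk> \<Longrightarrow> (Q *\<^sub>v w) $ i = 0"
proof -
  have Wc: "W \<subseteq> carrier_vec n" using W(1) by (simp add: subspace_of_iff)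
  define S where "S k \<longleftrightarrow> k \<le> n \<and> (\<exists>P\<in>carrier_mat n n. det P \<noteq> 0 \<and> (\<forall>j<k. col P j \<in> W))"
    for k :: nat
  have S0: "S 0" unfolding S_def by (auto intro!: bexI[of _ "1\<^sub>m n"])
  have Sb: "\<And>k. S k \<Longrightarrow> k \<le> n" by (simp add: S_def)
  define k where "k = Greatest S"
  have Sk: "S k" unfolding k_def by (rule GreatestI_nat[of S 0 n]) (use S0 Sb in auto)
  have max: "\<not> S (Suc k)"
    using Greatest_le_nat[of S "Suc k" n] Sb by (auto simp: k_def)
  obtain P where P: "P \<in> carrier_mat n n" "det P \<noteq> 0" "\<And>j. j < k \<Longrightarrow> col P j \<in> W"
    using Sk by (auto simp: S_def)
  obtain Q where Q: "Q \<in> carrier_mat n n" "P * Q = 1\<^sub>m n" "Q * P = 1\<^sub>m n"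
    using det_non_zero_imp_unit[OF P(1,2), of "()"] by (auto simp: Units_def ring_mat_simps)
  have PQ: "P *\<^sub>v (Q *\<^sub>v v) = v" if "v \<in> carrier_vec n" for v
    using assoc_mult_mat_vec[OF P(1) Q(1) that] Q(2) that by simp
  have zero: "(Q *\<^sub>v w) $ i = 0" if w: "w \<in> W" and i: "k \<le> i" "i < n" for w i
  proof (rule ccontr)
    assume nz: "(Q *\<^sub>v w) $ i \<noteq> 0"
    have wc: "w \<in> carrier_vec n" using w Wc by auto
    then have Qw: "Q *\<^sub>v w \<in> carrier_vec n" using Q by simp
    \<comment> \<open>Exchanging column i for w multiplies the determinant by the coordinate of w at i.\<close>
    define P1 where "P1 = replace_col P w i"
    have P1: "P1 \<in> carrier_mat n n" using P by (simp add: P1_def replace_col_def)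
    have d1: "det P1 \<noteq> 0"
      using cramer_lemma_mat[OF P(1) Qw i(2)] PQ[OF wc] nz P by (simp add: P1_def)
    define P2 where "P2 = (if i = k then P1 else swapcols k i P1)"
    have P2: "P2 \<in> carrier_mat n n" using P1 by (simp add: P2_def)
    have d2: "det P2 \<noteq> 0"
      using d1 det_swapcols[of k n i P1] i P1 by (auto simp: P2_def)
    have "col P2 j \<in> W" if "j < Suc k" for j
    proof (cases "j = k")
      case True
      have "col P2 k = w" using P1 P wc i
        by (intro eq_vecI) (auto simp: P2_def P1_def replace_col_def)
      then show ?thesis using w True by simp
    next
      case False
      then have "col P2 j = col P j" using that P1 P i
        by (intro eq_vecI) (auto simp: P2_def P1_def replace_col_def)
      then show ?thesis using P(3) False that by simp
    qed
    then have "S (Suc k)" using P2 d2 i by (auto simp: S_def)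
    then show False using max by simp
  qed
  have "k \<noteq> 0"
  proof
    assume "k = 0"
    have "w = 0\<^sub>v n" if w: "w \<in> W" for w
    proof -
      have wc: "w \<in> carrier_vec n" using w Wc by auto
      have "Q *\<^sub>v w = 0\<^sub>v n" using zero[OF w] Q \<open>k = 0\<close> by (intro eq_vecI) auto
      moreover have "P *\<^sub>v 0\<^sub>v n = 0\<^sub>v n" using P by (intro eq_vecI) auto
      ultimately show ?thesis using PQ[OF wc] by simp
    qed
    then show False using W by (auto simp: subspace_of_iff)
  qed
  moreover have "k \<noteq> n"
  proof
    assume "k = n"
    have "v \<in> W" if "v \<in> carrier_vec n" for v
      using subspace_of_columns[OF W(1) P(1), of "Q *\<^sub>v v"] P(3) Q PQ[OF that] that \<open>k = n\<close> by simp
    then show False using W Wc by auto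
  qed
  moreover have "k \<le> n" using Sk by (simp add: S_def)
  ultimately show ?thesis using that[of k P Q] P Q zero by simp
qed

text \<open>This is the averaging step of Maschke's theorem. For a block triangular representation with diagonal
blocks \<open>\<alpha>\<close>, \<open>\<delta>\<close> and upper right block \<open>B\<close>, multiplicativity is the cocycle
identity. A solution \<open>X\<close> of the conclusion makes the block unipotent matrix with upper right entry
\<open>X\<close> an isomorphism to the block diagonal representation. Summing the cocycle identity, multiplied by
\<open>\<delta>(h\<inverse>)\<close>, over all \<open>h\<close> shows that the average of \<open>B(h) \<delta>(h\<inverse>)\<close> is such a solution.\<close>

lemma cocycle_is_coboundary:
  assumes G: "group G" and fin: "finite (carrier G)"
    and \<alpha>: "group_rep G \<alpha>" and \<delta>: "group_rep G \<delta>"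
    and B: "\<And>g. g \<in> carrier G \<Longrightarrow> B g \<in> carrier_mat (fst \<alpha>) (fst \<delta>)"
    and cocycle: "\<And>g h. \<lbrakk>g \<in> carrier G; h \<in> carrier G\<rbrakk> \<Longrightarrow>
      B (g \<otimes>\<^bsub>G\<^esub> h) = snd \<alpha> g * B h + B g * snd \<delta> h"
  obtains X where "X \<in> carrier_mat (fst \<alpha>) (fst \<delta>)"
    "\<And>g. g \<in> carrier G \<Longrightarrow> snd \<alpha> g * X + B g = X * snd \<delta> g"
proof -
  interpret group G by fact
  let ?k = "fst \<alpha>" and ?m = "fst \<delta>"
  have ca: "\<And>g. g \<in> carrier G \<Longrightarrow> snd \<alpha> g \<in> carrier_mat ?k ?k"
    and cd: "\<And>g. g \<in> carrier G \<Longrightarrow> snd \<delta> g \<in> carrier_mat ?m ?m"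
    using group_rep_carrier[OF G] \<alpha> \<delta> by auto
  have N: "card (carrier G) \<noteq> 0" using fin one_closed by auto
  define Y where "Y = msum ?k ?m (\<lambda>h. B h * snd \<delta> (inv\<^bsub>G\<^esub> h)) (carrier G)"
  have Y: "Y \<in> carrier_mat ?k ?m" by (simp add: Y_def)
  have BD: "B h * snd \<delta> (inv\<^bsub>G\<^esub> h) \<in> carrier_mat ?k ?m" if "h \<in> carrier G" for h
    using B cd that by (meson inv_closed mult_carrier_mat)
  have key: "snd \<alpha> g * Y + of_nat (card (carrier G)) \<cdot>\<^sub>m B g = Y * snd \<delta> g"
    if g: "g \<in> carrier G" for g
  proof -
    have "Y * snd \<delta> g = msum ?k ?m (\<lambda>h. B h * snd \<delta> (inv\<^bsub>G\<^esub> h) * snd \<delta> g) (carrier G)"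
      unfolding Y_def by (intro msum_mult cd g BD)
    also have "\<dots> = msum ?k ?m (\<lambda>h. B (g \<otimes>\<^bsub>G\<^esub> h) * snd \<delta> (inv\<^bsub>G\<^esub> (g \<otimes>\<^bsub>G\<^esub> h)) * snd \<delta> g) (carrier G)"
      by (rule msum_translate[OF G g, symmetric])
    also have "\<dots> = msum ?k ?m (\<lambda>h. snd \<alpha> g * (B h * snd \<delta> (inv\<^bsub>G\<^esub> h)) + B g) (carrier G)"
    proof (rule msum_cong)
      fix h assume h: "h \<in> carrier G"
      have *: "snd \<delta> (inv\<^bsub>G\<^esub> (g \<otimes>\<^bsub>G\<^esub> h)) * snd \<delta> g = snd \<delta> (inv\<^bsub>G\<^esub> h)"
        using group_rep_mult[OF G \<delta>, of "inv\<^bsub>G\<^esub> (g \<otimes>\<^bsub>G\<^esub> h)" g] g h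
        by (simp add: inv_mult_group m_assoc)
      have "B (g \<otimes>\<^bsub>G\<^esub> h) * snd \<delta> (inv\<^bsub>G\<^esub> (g \<otimes>\<^bsub>G\<^esub> h)) * snd \<delta> g
          = B (g \<otimes>\<^bsub>G\<^esub> h) * (snd \<delta> (inv\<^bsub>G\<^esub> (g \<otimes>\<^bsub>G\<^esub> h)) * snd \<delta> g)"
        using g h by (intro assoc_mult_mat[of _ ?k ?m _ ?m _ ?m] B cd) auto
      also have "\<dots> = (snd \<alpha> g * B h + B g * snd \<delta> h) * snd \<delta> (inv\<^bsub>G\<^esub> h)"
        unfolding * cocycle[OF g h] ..
      also have "\<dots> = snd \<alpha> g * B h * snd \<delta> (inv\<^bsub>G\<^esub> h) + B g * snd \<delta> h * snd \<delta> (inv\<^bsub>G\<^esub> h)"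
        using g h 
        by (intro add_mult_distrib_mat[of _ ?k ?m _ _ ?m] mult_carrier_mat[OF ca B] mult_carrier_mat[OF B cd] cd) auto
      also have "snd \<alpha> g * B h * snd \<delta> (inv\<^bsub>G\<^esub> h) = snd \<alpha> g * (B h * snd \<delta> (inv\<^bsub>G\<^esub> h))"
        using g h by (intro assoc_mult_mat[of _ ?k ?k _ ?m _ ?m] ca B cd) auto
      also have "B g * snd \<delta> h * snd \<delta> (inv\<^bsub>G\<^esub> h) = B g * (snd \<delta> h * snd \<delta> (inv\<^bsub>G\<^esub> h))"
        using g h by (intro assoc_mult_mat[of _ ?k ?m _ ?m _ ?m] B cd) auto
      also have "\<dots> = B g"
        using group_rep_inv_mult[OF G \<delta> h] B[OF g] by simp
      finally show "B (g \<otimes>\<^bsub>G\<^esub> h) * snd \<delta> (inv\<^bsub>G\<^esub> (g \<otimes>\<^bsub>G\<^esub> h)) * snd \<delta> g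
          = snd \<alpha> g * (B h * snd \<delta> (inv\<^bsub>G\<^esub> h)) + B g" .
    qed
    also have "\<dots> = msum ?k ?m (\<lambda>h. snd \<alpha> g * (B h * snd \<delta> (inv\<^bsub>G\<^esub> h))) (carrier G)
        + of_nat (card (carrier G)) \<cdot>\<^sub>m B g"
      using B[OF g] by (intro eq_matI) (auto simp: sum.distrib)
    also have "msum ?k ?m (\<lambda>h. snd \<alpha> g * (B h * snd \<delta> (inv\<^bsub>G\<^esub> h))) (carrier G) = snd \<alpha> g * Y"
      unfolding Y_def by (intro mult_msum[symmetric] ca g BD)
    finally show ?thesis by simp
  qed
  define X where "X = (1 / of_nat (card (carrier G)) :: complex) \<cdot>\<^sub>m Y"
  have X: "X \<in> carrier_mat ?k ?m" using Y by (simp add: X_def)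
  have "snd \<alpha> g * X + B g = X * snd \<delta> g" if g: "g \<in> carrier G" for g
  proof -
    have "X * snd \<delta> g = (1 / of_nat (card (carrier G))) \<cdot>\<^sub>m (Y * snd \<delta> g)"
      unfolding X_def by (rule mult_smult_assoc_mat[OF Y cd[OF g]])
    also have "\<dots> = (1 / of_nat (card (carrier G))) \<cdot>\<^sub>m (snd \<alpha> g * Y) + B g"
      unfolding key[OF g, symmetric] using B[OF g] Y ca[OF g] N by (intro eq_matI) (auto simp: field_simps)
    also have "(1 / of_nat (card (carrier G))) \<cdot>\<^sub>m (snd \<alpha> g * Y) = snd \<alpha> g * X"
      unfolding X_def by (rule mult_smult_distrib[OF ca[OF g] Y, symmetric])
    finally show ?thesis by simp
  qed
  with X show ?thesis by (rule that)
qed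


text \<open>In a basis adapted to the invariant subspace the representation is block upper triangular; the off
diagonal block is then removed by the coboundary of the previous lemma.\<close>

lemma Maschke_split:
  assumes G: "group G" and fin: "finite (carrier G)" and \<rho>: "group_rep G \<rho>"
    and W: "subspace_of (fst \<rho>) W" "W \<noteq> {0\<^sub>v (fst \<rho>)}" "W \<noteq> carrier_vec (fst \<rho>)"
    and inv: "\<And>g w. \<lbrakk>g \<in> carrier G; w \<in> W\<rbrakk> \<Longrightarrow> snd \<rho> g *\<^sub>v w \<in> W"
  obtains \<alpha> \<delta> where "fst \<alpha> < fst \<rho>" "fst \<delta> < fst \<rho>" "group_rep G \<alpha>" "group_rep G \<delta>"
    "rep_iso_on (carrier G) \<rho> (rep_sum [\<alpha>, \<delta>])"
proof -
  interpret group G by fact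
  let ?n = "fst \<rho>"
  obtain k P Q where k: "0 < k" "k < ?n" and P: "P \<in> carrier_mat ?n ?n" and Q: "Q \<in> carrier_mat ?n ?n"
    and PQ: "P * Q = 1\<^sub>m ?n" and QP: "Q * P = 1\<^sub>m ?n" and cols: "\<And>j. j < k \<Longrightarrow> col P j \<in> W"
    and zero: "\<And>w i. \<lbrakk>w \<in> W; k \<le> i; i < ?n\<rbrakk> \<Longrightarrow> (Q *\<^sub>v w) $ i = 0"
    using adapted_basis[OF W] by metis
  define m where "m = ?n - k"
  have n: "?n = k + m" using k by (simp add: m_def)
  have car: "\<And>g. g \<in> carrier G \<Longrightarrow> snd \<rho> g \<in> carrier_mat ?n ?n"
    using group_rep_carrier[OF G \<rho>] .
  define \<sigma> where "\<sigma> g = Q * (snd \<rho> g * P)" for g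
  have \<sigma>: "\<sigma> g \<in> carrier_mat ?n ?n" if "g \<in> carrier G" for g
    using car[OF that] P Q by (simp add: \<sigma>_def)
  have \<rho>P: "snd \<rho> g * P = P * \<sigma> g" if g: "g \<in> carrier G" for g
    using assoc_mult_mat[OF P Q mult_carrier_mat[OF car[OF g] P]] PQ car[OF g] P
    by (simp add: \<sigma>_def)
  have \<sigma>_mult: "\<sigma> (g \<otimes>\<^bsub>G\<^esub> h) = \<sigma> g * \<sigma> h" if g: "g \<in> carrier G" and h: "h \<in> carrier G" for g h
  proof -
    note cg = car[OF g] and ch = car[OF h]
    have "\<sigma> (g \<otimes>\<^bsub>G\<^esub> h) = Q * (snd \<rho> g * (snd \<rho> h * P))"
      using assoc_mult_mat[OF cg ch P] by (simp add: \<sigma>_def group_rep_mult[OF G \<rho> g h])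
    also have "snd \<rho> g * (snd \<rho> h * P) = snd \<rho> g * P * \<sigma> h"
      unfolding \<rho>P[OF h] by (rule assoc_mult_mat[OF cg P \<sigma>[OF h], symmetric])
    also have "Q * \<dots> = \<sigma> g * \<sigma> h"
      unfolding \<sigma>_def[of g] by (rule assoc_mult_mat[OF Q mult_carrier_mat[OF cg P] \<sigma>[OF h], symmetric])
    finally show ?thesis .
  qed
  have \<sigma>_one: "\<sigma> \<one>\<^bsub>G\<^esub> = 1\<^sub>m ?n"
    using P QP by (simp add: \<sigma>_def group_rep_one[OF G \<rho>])
  have \<sigma>_zero: "\<sigma> g $$ (i, j) = 0" if g: "g \<in> carrier G" and ij: "j < k" "k \<le> i" "i < ?n" for g i j
  proof -
    have "\<sigma> g $$ (i, j) = (Q *\<^sub>v (snd \<rho> g *\<^sub>v col P j)) $ i"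
      using ij n k P Q car[OF g] by (simp add: \<sigma>_def col_mult2 mult_mat_vec_def)
    also have "\<dots> = 0" by (intro zero inv g cols ij)
    finally show ?thesis .
  qed
  \<comment> \<open>The blocks; the lower left one vanishes because the first k basis vectors span an invariant space.\<close>
  define A B D where "A g = mat k k (\<lambda>(i, j). \<sigma> g $$ (i, j))"
    and "B g = mat k m (\<lambda>(i, j). \<sigma> g $$ (i, j + k))"
    and "D g = mat m m (\<lambda>(i, j). \<sigma> g $$ (i + k, j + k))" for g
  have cA: "A g \<in> carrier_mat k k" and cB: "B g \<in> carrier_mat k m" and cD: "D g \<in> carrier_mat m m" for g
    by (simp_all add: A_def B_def D_def)
  have block: "\<sigma> g = four_block_mat (A g) (B g) (0\<^sub>m m k) (D g)" if g: "g \<in> carrier G" for g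
    using \<sigma>[OF g] \<sigma>_zero[OF g] n by (intro eq_matI) (auto simp: A_def B_def D_def)
  have mult: "A (g \<otimes>\<^bsub>G\<^esub> h) = A g * A h" "B (g \<otimes>\<^bsub>G\<^esub> h) = A g * B h + B g * D h"
    "D (g \<otimes>\<^bsub>G\<^esub> h) = D g * D h" if g: "g \<in> carrier G" and h: "h \<in> carrier G" for g h
  proof -
    have "four_block_mat (A (g \<otimes>\<^bsub>G\<^esub> h)) (B (g \<otimes>\<^bsub>G\<^esub> h)) (0\<^sub>m m k) (D (g \<otimes>\<^bsub>G\<^esub> h)) = \<sigma> g * \<sigma> h"
      using block[of "g \<otimes>\<^bsub>G\<^esub> h"] \<sigma>_mult[OF g h] g h by simp
    also have "\<dots> = four_block_mat (A g * A h + B g * 0\<^sub>m m k) (A g * B h + B g * D h)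
       (0\<^sub>m m k * A h + D g * 0\<^sub>m m k) (0\<^sub>m m k * B h + D g * D h)"
      unfolding block[OF g] block[OF h]
      by (rule mult_four_block_mat[OF cA cB _ cD cA cB _ cD]) auto
    also have "\<dots> = four_block_mat (A g * A h) (A g * B h + B g * D h) (0\<^sub>m m k) (D g * D h)"
      using cA[of g] cA[of h] cB[of g] cB[of h] cD[of g] cD[of h] by simp
    finally have e: "four_block_mat (A (g \<otimes>\<^bsub>G\<^esub> h)) (B (g \<otimes>\<^bsub>G\<^esub> h)) (0\<^sub>m m k) (D (g \<otimes>\<^bsub>G\<^esub> h)) =
      four_block_mat (A g * A h) (A g * B h + B g * D h) (0\<^sub>m m k) (D g * D h)" .
    have c: "A g * A h \<in> carrier_mat k k" "A g * B h + B g * D h \<in> carrier_mat k m"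
      "D g * D h \<in> carrier_mat m m"
      using cA[of g] cA[of h] cB[of g] cB[of h] cD[of g] cD[of h] by auto
    show "A (g \<otimes>\<^bsub>G\<^esub> h) = A g * A h" "B (g \<otimes>\<^bsub>G\<^esub> h) = A g * B h + B g * D h"
      "D (g \<otimes>\<^bsub>G\<^esub> h) = D g * D h"
      using four_block_inject[OF e cA cB _ cD c(1,2) _ c(3)] by auto
  qed
  have one: "A \<one>\<^bsub>G\<^esub> = 1\<^sub>m k" "D \<one>\<^bsub>G\<^esub> = 1\<^sub>m m"
    unfolding A_def D_def \<sigma>_one using n by (auto intro!: eq_matI)
  have \<alpha>: "group_rep G (k, A)" and \<delta>: "group_rep G (m, D)"
    using mult one cA cD by (auto simp: group_rep_iff[OF G])
  obtain X where X: "X \<in> carrier_mat k m"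
    and AX: "\<And>g. g \<in> carrier G \<Longrightarrow> A g * X + B g = X * D g"
    using cocycle_is_coboundary[OF G fin \<alpha> \<delta>, of B] cB mult(2) by auto
  \<comment> \<open>The unipotent matrix that removes the off-diagonal block.\<close>
  define T where "T = four_block_mat (1\<^sub>m k) X (0\<^sub>m m k) (1\<^sub>m m)"
  define T' where "T' = four_block_mat (1\<^sub>m k) (- X) (0\<^sub>m m k) (1\<^sub>m m)"
  have T: "T \<in> carrier_mat ?n ?n" "T' \<in> carrier_mat ?n ?n" using X by (simp_all add: T_def T'_def n)
  have TT: "T * T' = 1\<^sub>m ?n" "T' * T = 1\<^sub>m ?n"
    unfolding T_def T'_def using X
    by (subst mult_four_block_mat[OF one_carrier_mat _ zero_carrier_mat one_carrier_mat
          one_carrier_mat _ zero_carrier_mat one_carrier_mat]; auto simp: n intro!: eq_matI)+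
  let ?d = "\<lambda>g. four_block_mat (A g) (0\<^sub>m k m) (0\<^sub>m m k) (D g)"
  have \<sigma>T: "\<sigma> g * T = T * ?d g" if g: "g \<in> carrier G" for g
  proof -
    have "\<sigma> g * T = four_block_mat (A g * 1\<^sub>m k + B g * 0\<^sub>m m k) (A g * X + B g * 1\<^sub>m m)
        (0\<^sub>m m k * 1\<^sub>m k + D g * 0\<^sub>m m k) (0\<^sub>m m k * X + D g * 1\<^sub>m m)"
      unfolding T_def block[OF g]
      by (rule mult_four_block_mat[OF cA cB _ cD _ X]) auto
    also have "\<dots> = four_block_mat (A g) (X * D g) (0\<^sub>m m k) (D g)"
      using cA[of g] cB[of g] cD[of g] X AX[OF g] by simp
    also have "\<dots> = four_block_mat (1\<^sub>m k * A g + X * 0\<^sub>m m k) (1\<^sub>m k * 0\<^sub>m k m + X * D g)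
        (0\<^sub>m m k * A g + 1\<^sub>m m * 0\<^sub>m m k) (0\<^sub>m m k * 0\<^sub>m k m + 1\<^sub>m m * D g)"
      using cA[of g] cD[of g] X by simp
    also have "\<dots> = T * ?d g"
      unfolding T_def by (rule mult_four_block_mat[OF _ X _ _ cA _ _ cD, symmetric]) auto
    finally show ?thesis .
  qed
  have s: "snd (rep_sum [(k, A), (m, D)]) g = ?d g" for g
    by (subst rep_sum_append[of "[(k, A)]" "[(m, D)]" g, simplified])
      (use cA[of g] cD[of g] in \<open>auto simp: rep_sum_single\<close>)
  have "rep_iso_on (carrier G) \<rho> (rep_sum [(k, A), (m, D)])"
  proof (rule rep_iso_onI[where P = "P * T" and Q = "T' * Q"])
    show "fst \<rho> = fst (rep_sum [(k, A), (m, D)])" using n by (simp add: rep_sum_def)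
    have "P * T * (T' * Q) = P * (T * T' * Q)"
      using P T Q by (simp add: assoc_mult_mat[of _ ?n ?n _ ?n _ ?n])
    then show "P * T * (T' * Q) = 1\<^sub>m ?n" using P Q TT PQ by simp
    have "T' * Q * (P * T) = T' * (Q * P * T)"
      using P T Q by (simp add: assoc_mult_mat[of _ ?n ?n _ ?n _ ?n])
    then show "T' * Q * (P * T) = 1\<^sub>m ?n" using T TT QP by simp
    show "snd \<rho> g * (P * T) = P * T * snd (rep_sum [(k, A), (m, D)]) g" if g: "g \<in> carrier G" for g
    proof -
      have d: "?d g \<in> carrier_mat ?n ?n" using cA[of g] cD[of g] n by simp
      have "snd \<rho> g * (P * T) = P * \<sigma> g * T"
        using assoc_mult_mat[OF car[OF g] P T(1)] \<rho>P[OF g] by simp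
      also have "\<dots> = P * (T * ?d g)"
        using assoc_mult_mat[OF P \<sigma>[OF g] T(1)] \<sigma>T[OF g] by simp
      also have "\<dots> = P * T * ?d g"
        by (rule assoc_mult_mat[OF P T(1) d, symmetric])
      finally show ?thesis by (simp add: s)
    qed
    show "snd (rep_sum [(k, A), (m, D)]) g \<in> carrier_mat ?n ?n" for g
      unfolding s n using cA[of g] cD[of g] by simp
  qed (use P Q T car in auto)
  moreover have "m < ?n" using k by (simp add: m_def)
  ultimately show ?thesis using that[of "(k, A)" "(m, D)"] k \<alpha> \<delta> by simp
qed

section \<open>Representations without trivial constituents\<close>

lemma msum_rep_sum_zero:
  assumes "\<And>\<sigma> s. \<lbrakk>\<sigma> \<in> set \<sigma>s; s \<in> S\<rbrakk> \<Longrightarrow> snd \<sigma> s \<in> carrier_mat (fst \<sigma>) (fst \<sigma>)"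
    and "\<And>\<sigma>. \<sigma> \<in> set \<sigma>s \<Longrightarrow> msum (fst \<sigma>) (fst \<sigma>) (snd \<sigma>) S = 0\<^sub>m (fst \<sigma>) (fst \<sigma>)"
  shows "msum (fst (rep_sum \<sigma>s)) (fst (rep_sum \<sigma>s)) (snd (rep_sum \<sigma>s)) S
    = 0\<^sub>m (fst (rep_sum \<sigma>s)) (fst (rep_sum \<sigma>s))"
  using assms
proof (induction \<sigma>s)
  case Nil
  then show ?case by (auto simp: rep_sum_Nil intro!: eq_matI)
next
  case (Cons \<sigma> \<sigma>s)
  let ?k = "fst \<sigma>" and ?m = "fst (rep_sum \<sigma>s)"
  have c: "snd \<sigma> s \<in> carrier_mat ?k ?k" "snd (rep_sum \<sigma>s) s \<in> carrier_mat ?m ?m" if "s \<in> S" for s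
    using Cons.prems(1) that by (auto intro: rep_sum_carrier)
  have "msum (?k + ?m) (?k + ?m) (snd (rep_sum (\<sigma> # \<sigma>s))) S =
    msum (?k + ?m) (?k + ?m) (\<lambda>s. four_block_mat (snd \<sigma> s) (0\<^sub>m ?k ?m) (0\<^sub>m ?m ?k) (snd (rep_sum \<sigma>s) s)) S"
    using rep_sum_append[of "[\<sigma>]" \<sigma>s] Cons.prems(1)
    by (intro msum_cong) (simp add: rep_sum_single)
  also have "\<dots> = four_block_mat (msum ?k ?k (snd \<sigma>) S) (0\<^sub>m ?k ?m) (0\<^sub>m ?m ?k) (msum ?m ?m (snd (rep_sum \<sigma>s)) S)"
    by (rule msum_four_block) (use c in auto)
  also have "\<dots> = 0\<^sub>m (?k + ?m) (?k + ?m)"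
    using Cons by simp
  finally show ?case by simp
qed

text \<open>The columns of the sum are fixed vectors. If one of them is non-zero, the line it spans is invariant
and therefore the whole space, so the representation is the trivial one.\<close>

lemma msum_nontrivial_irreducible:
  assumes G: "group G" and fin: "finite (carrier G)" and \<sigma>: "group_rep G \<sigma>"
    and irr: "irreducible_on (carrier G) \<sigma>" and nt: "\<not> rep_iso_on (carrier G) \<sigma> trivial_rep"
  shows "msum (fst \<sigma>) (fst \<sigma>) (snd \<sigma>) (carrier G) = 0\<^sub>m (fst \<sigma>) (fst \<sigma>)"
proof (rule ccontr)
  interpret group G by fact
  let ?n = "fst \<sigma>" and ?M = "msum (fst \<sigma>) (fst \<sigma>) (snd \<sigma>) (carrier G)"
  assume ne: "?M \<noteq> 0\<^sub>m ?n ?n"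
  have car: "\<And>g. g \<in> carrier G \<Longrightarrow> snd \<sigma> g \<in> carrier_mat ?n ?n"
    using group_rep_carrier[OF G \<sigma>] .
  obtain v where v: "v \<in> carrier_vec ?n" "?M *\<^sub>v v \<noteq> 0\<^sub>m ?n ?n *\<^sub>v v"
    using mat_eq_if_mult_vec_eq[of ?M ?n ?n "0\<^sub>m ?n ?n"] ne by auto
  define w where "w = ?M *\<^sub>v v"
  have w: "w \<in> carrier_vec ?n" "w \<noteq> 0\<^sub>v ?n"
    using v mult_mat_vec_carrier[OF msum_carrier v(1)] by (auto simp: w_def)
  have fixed: "snd \<sigma> g *\<^sub>v w = w" if g: "g \<in> carrier G" for g
  proof -
    have "snd \<sigma> g * ?M = msum ?n ?n (\<lambda>h. snd \<sigma> g * snd \<sigma> h) (carrier G)"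
      by (intro mult_msum car g)
    also have "\<dots> = msum ?n ?n (\<lambda>h. snd \<sigma> (g \<otimes>\<^bsub>G\<^esub> h)) (carrier G)"
      by (rule msum_cong) (simp add: group_rep_mult[OF G \<sigma> g])
    also have "\<dots> = ?M" by (rule msum_translate[OF G g])
    finally have "snd \<sigma> g * ?M = ?M" .
    then show ?thesis
      using assoc_mult_mat_vec[OF car[OF g] msum_carrier[of ?n ?n "snd \<sigma>" "carrier G"] v(1)]
      unfolding w_def by metis
  qed
  define W where "W = range (\<lambda>c. c \<cdot>\<^sub>v w)"
  have "subspace_of ?n W" unfolding subspace_of_iff
  proof (intro conjI ballI allI)
    show "0\<^sub>v ?n \<in> W" using w unfolding W_def by (intro range_eqI[of _ _ 0]) auto
    show "u + x \<in> W" if "u \<in> W" "x \<in> W" for u x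
      using that unfolding W_def by (auto simp: add_smult_distrib_vec[symmetric])
    show "c \<cdot>\<^sub>v u \<in> W" if "u \<in> W" for c u
      using that unfolding W_def by (auto simp: smult_smult_assoc)
  qed (use w in \<open>auto simp: W_def\<close>)
  moreover have "snd \<sigma> g *\<^sub>v u \<in> W" if "g \<in> carrier G" "u \<in> W" for g u
    using that fixed mult_mat_vec[OF car[OF that(1)] w(1)] unfolding W_def by auto
  moreover have "1 \<cdot>\<^sub>v w \<in> W" unfolding W_def by blast
  then have "W \<noteq> {0\<^sub>v ?n}" using w by auto
  ultimately have W: "W = carrier_vec ?n" using irreducible_on_cases[OF irr] by blast
  have n0: "?n \<noteq> 0" using irr by (simp add: irreducible_on_def)
  \<comment> \<open>Two unit vectors cannot both be multiples of w.\<close>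
  have "\<not> 2 \<le> ?n"
  proof
    assume n2: "2 \<le> ?n"
    have "unit_vec ?n 0 \<in> W" "unit_vec ?n 1 \<in> W" unfolding W by auto
    then obtain a b where ab: "unit_vec ?n 0 = a \<cdot>\<^sub>v w" "unit_vec ?n 1 = b \<cdot>\<^sub>v w"
      unfolding W_def by auto
    have "a * w $ 0 = 1" "a * w $ 1 = 0" "b * w $ 1 = 1"
      using arg_cong[OF ab(1), of "\<lambda>v. v $ 0"] arg_cong[OF ab(1), of "\<lambda>v. v $ 1"]
        arg_cong[OF ab(2), of "\<lambda>v. v $ 1"] n2 w by auto
    then show False by auto
  qed
  then have n1: "?n = 1" using n0 by simp
  have "snd \<sigma> g = 1\<^sub>m 1" if g: "g \<in> carrier G" for g
  proof -
    have "snd \<sigma> g = 1\<^sub>m ?n"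
    proof (rule mat_eq_if_mult_vec_eq[OF car[OF g] one_carrier_mat])
      fix u :: "complex vec" assume u: "u \<in> carrier_vec ?n"
      then obtain c where "u = c \<cdot>\<^sub>v w" using W unfolding W_def by auto
      then show "snd \<sigma> g *\<^sub>v u = 1\<^sub>m ?n *\<^sub>v u"
        using fixed[OF g] mult_mat_vec[OF car[OF g] w(1)] u by simp
    qed
    then show ?thesis using n1 by simp
  qed
  then have "rep_iso_on (carrier G) \<sigma> trivial_rep"
    using n1 by (intro rep_iso_onI[where P = "1\<^sub>m 1" and Q = "1\<^sub>m 1"]) (auto simp: trivial_rep_def)
  then show False using nt by simp
qed

text \<open>Complete reducibility by induction on the dimension. The vanishing of the sum passes to both summands
of a splitting, and it excludes the trivial representation, for which the sum is the group order.\<close>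

lemma sum_of_nontrivial_if_msum_zero:
  assumes G: "group G" and fin: "finite (carrier G)" and "group_rep G \<rho>"
    and "msum (fst \<rho>) (fst \<rho>) (snd \<rho>) (carrier G) = 0\<^sub>m (fst \<rho>) (fst \<rho>)"
  shows "sum_of_nontrivial G \<rho>"
  using assms(3,4)
proof (induction "fst \<rho>" arbitrary: \<rho> rule: less_induct)
  case less
  interpret group G by fact
  let ?n = "fst \<rho>"
  note \<rho> = less.prems(1) and zero = less.prems(2)
  have car: "\<And>g. g \<in> carrier G \<Longrightarrow> snd \<rho> g \<in> carrier_mat ?n ?n"
    using group_rep_carrier[OF G \<rho>] .
  consider "?n = 0" | "irreducible_on (carrier G) \<rho>" | W where "subspace_of ?n W"
    "W \<noteq> {0\<^sub>v ?n}" "W \<noteq> carrier_vec ?n" "\<And>g w. \<lbrakk>g \<in> carrier G; w \<in> W\<rbrakk> \<Longrightarrow> snd \<rho> g *\<^sub>v w \<in> W"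
    unfolding irreducible_on_def by blast
  then show ?case
  proof cases
    case 1
    have "rep_iso_on (carrier G) \<rho> (rep_sum [])"
      using car[THEN carrier_matD(1)] car[THEN carrier_matD(2)] 1
      by (intro rep_iso_onI[where P = "1\<^sub>m 0" and Q = "1\<^sub>m 0"])
        (auto simp: rep_sum_Nil intro!: eq_matI carrier_matI)
    then show ?thesis unfolding sum_of_nontrivial_def by (intro exI[of _ "[]"]) auto
  next
    case 2
    have "\<not> rep_iso_on (carrier G) \<rho> trivial_rep"
    proof
      assume iso: "rep_iso_on (carrier G) \<rho> trivial_rep"
      then have "msum 1 1 (snd trivial_rep) (carrier G) = (0\<^sub>m 1 1 :: complex mat)"
        using rep_iso_on_msum_zero[OF rep_iso_on_sym[OF iso]] zero
        by (auto simp: trivial_rep_def rep_iso_on_def)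
      then have "msum 1 1 (snd trivial_rep) (carrier G) $$ (0, 0) = (0 :: complex)" by simp
      then show False using fin one_closed by (auto simp: trivial_rep_def)
    qed
    then show ?thesis unfolding sum_of_nontrivial_def using \<rho> 2 car
      by (intro exI[of _ "[\<rho>]"]) (auto simp: rep_sum_single intro: rep_iso_on_refl)
  next
    case 3
    obtain \<alpha> \<delta> where ad: "fst \<alpha> < ?n" "fst \<delta> < ?n" "group_rep G \<alpha>" "group_rep G \<delta>"
      and iso: "rep_iso_on (carrier G) \<rho> (rep_sum [\<alpha>, \<delta>])"
      using Maschke_split[OF G fin \<rho> 3] by metis
    let ?k = "fst \<alpha>" and ?m = "fst \<delta>"
    have c: "snd \<alpha> g \<in> carrier_mat ?k ?k" "snd \<delta> g \<in> carrier_mat ?m ?m" if "g \<in> carrier G" for g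
      using that group_rep_carrier[OF G] ad by auto
    have "msum (?k + ?m) (?k + ?m) (snd (rep_sum [\<alpha>, \<delta>])) (carrier G) = 0\<^sub>m (?k + ?m) (?k + ?m)"
      using rep_iso_on_msum_zero[OF rep_iso_on_sym[OF iso]] zero rep_sum_carrier[of "[\<alpha>, \<delta>]"] c
      by (auto simp: rep_sum_Nil)
    moreover have "msum (?k + ?m) (?k + ?m) (snd (rep_sum [\<alpha>, \<delta>])) (carrier G) =
      msum (?k + ?m) (?k + ?m) (\<lambda>g. four_block_mat (snd \<alpha> g) (0\<^sub>m ?k ?m) (0\<^sub>m ?m ?k) (snd \<delta> g)) (carrier G)"
      using rep_sum_append[of "[\<alpha>]" "[\<delta>]"] c by (intro msum_cong) (auto simp: rep_sum_single)
    moreover have "\<dots> = four_block_mat (msum ?k ?k (snd \<alpha>) (carrier G)) (0\<^sub>m ?k ?m) (0\<^sub>m ?m ?k)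
      (msum ?m ?m (snd \<delta>) (carrier G))"
      by (rule msum_four_block) (use c in auto)
    ultimately have e: "four_block_mat (msum ?k ?k (snd \<alpha>) (carrier G)) (0\<^sub>m ?k ?m) (0\<^sub>m ?m ?k)
      (msum ?m ?m (snd \<delta>) (carrier G)) = four_block_mat (0\<^sub>m ?k ?k) (0\<^sub>m ?k ?m) (0\<^sub>m ?m ?k) (0\<^sub>m ?m ?m)"
      by simp
    have "msum ?k ?k (snd \<alpha>) (carrier G) = 0\<^sub>m ?k ?k" "msum ?m ?m (snd \<delta>) (carrier G) = 0\<^sub>m ?m ?m"
      using four_block_inject(1,3)[OF e msum_carrier _ _ msum_carrier] by auto
    then have "sum_of_nontrivial G \<alpha>" "sum_of_nontrivial G \<delta>" using less.hyps ad by auto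
    then obtain xs ys where xs: "\<forall>\<sigma>\<in>set xs. group_rep G \<sigma> \<and> irreducible_on (carrier G) \<sigma> \<and>
          \<not> rep_iso_on (carrier G) \<sigma> trivial_rep" "rep_iso_on (carrier G) \<alpha> (rep_sum xs)"
      and ys: "\<forall>\<sigma>\<in>set ys. group_rep G \<sigma> \<and> irreducible_on (carrier G) \<sigma> \<and>
          \<not> rep_iso_on (carrier G) \<sigma> trivial_rep" "rep_iso_on (carrier G) \<delta> (rep_sum ys)"
      unfolding sum_of_nontrivial_def by blast
    have "rep_iso_on (carrier G) (rep_sum [\<alpha>, \<delta>]) (rep_sum (xs @ ys))"
      using xs ys c group_rep_carrier[OF G] by (intro rep_iso_on_rep_sum_append) auto
    then have "rep_iso_on (carrier G) \<rho> (rep_sum (xs @ ys))" by (rule rep_iso_on_trans[OF iso])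
    then show ?thesis unfolding sum_of_nontrivial_def using xs(1) ys(1)
      by (intro exI[of _ "xs @ ys"]) auto
  qed
qed

lemma sum_of_nontrivial_iff:
  assumes G: "group G" and fin: "finite (carrier G)" and \<rho>: "group_rep G \<rho>"
  shows "sum_of_nontrivial G \<rho> \<longleftrightarrow>
    msum (fst \<rho>) (fst \<rho>) (snd \<rho>) (carrier G) = 0\<^sub>m (fst \<rho>) (fst \<rho>)"
proof
  assume "sum_of_nontrivial G \<rho>"
  then obtain \<sigma>s where \<sigma>s: "\<forall>\<sigma>\<in>set \<sigma>s. group_rep G \<sigma> \<and> irreducible_on (carrier G) \<sigma> \<and>
          \<not> rep_iso_on (carrier G) \<sigma> trivial_rep" and iso: "rep_iso_on (carrier G) \<rho> (rep_sum \<sigma>s)"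
    unfolding sum_of_nontrivial_def by blast
  have "msum (fst (rep_sum \<sigma>s)) (fst (rep_sum \<sigma>s)) (snd (rep_sum \<sigma>s)) (carrier G)
    = 0\<^sub>m (fst (rep_sum \<sigma>s)) (fst (rep_sum \<sigma>s))"
    using \<sigma>s group_rep_carrier[OF G] msum_nontrivial_irreducible[OF G fin]
    by (intro msum_rep_sum_zero) auto
  then show "msum (fst \<rho>) (fst \<rho>) (snd \<rho>) (carrier G) = 0\<^sub>m (fst \<rho>) (fst \<rho>)"
    using rep_iso_on_msum_zero[OF iso group_rep_carrier[OF G \<rho>]] by simp
qed (rule sum_of_nontrivial_if_msum_zero[OF assms])

section \<open>Structure constants of a fusion ring\<close>

context fusion_ring
begin

lemma basis_closed: "x \<in> B \<Longrightarrow> x \<in> carrier R"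
  using basis_subset by auto

lemma int_expansion_coeff: "r \<in> carrier R \<Longrightarrow> int_expansion R B r (coeff R B r)"
  unfolding coeff_def by (rule theI'[OF basis])

lemma coeff_eqI: "\<lbrakk>r \<in> carrier R; int_expansion R B r c\<rbrakk> \<Longrightarrow> coeff R B r = c"
  unfolding coeff_def by (rule the1_equality[OF basis])

lemma coeff_outside: "\<lbrakk>r \<in> carrier R; z \<notin> B\<rbrakk> \<Longrightarrow> coeff R B r z = 0"
  using int_expansion_coeff by (simp add: int_expansion_def)

lemma basis_expansion: "r \<in> carrier R \<Longrightarrow> r = (\<Oplus>x\<in>B. [coeff R B r x] \<cdot> x)"
  using int_expansion_coeff by (simp add: int_expansion_def)

lemma coeff_inject: "\<lbrakk>r \<in> carrier R; s \<in> carrier R; \<And>z. coeff R B r z = coeff R B s z\<rbrakk> \<Longrightarrow> r = s"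
  using basis_expansion[of r] basis_expansion[of s] by simp

lemma coeff_add:
  assumes r: "r \<in> carrier R" and s: "s \<in> carrier R"
  shows "coeff R B (r \<oplus> s) z = coeff R B r z + coeff R B s z"
proof -
  have "int_expansion R B (r \<oplus> s) (\<lambda>z. coeff R B r z + coeff R B s z)"
    unfolding int_expansion_def
  proof (intro conjI allI impI)
    have "r \<oplus> s = (\<Oplus>x\<in>B. [coeff R B r x] \<cdot> x) \<oplus> (\<Oplus>x\<in>B. [coeff R B s x] \<cdot> x)"
      using basis_expansion r s by metis
    also have "\<dots> = (\<Oplus>x\<in>B. ([coeff R B r x] \<cdot> x) \<oplus> ([coeff R B s x] \<cdot> x))"
      by (rule finsum_addf[symmetric]) (auto simp: basis_closed)
    also have "\<dots> = (\<Oplus>x\<in>B. [(coeff R B r x + coeff R B s x)] \<cdot> x)"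
      by (rule finsum_cong') (auto simp: basis_closed add.int_pow_mult)
    finally show "r \<oplus> s = (\<Oplus>x\<in>B. [(coeff R B r x + coeff R B s x)] \<cdot> x)" .
  qed (use r s coeff_outside in auto)
  then show ?thesis using coeff_eqI[of "r \<oplus> s"] r s by simp
qed

lemma coeff_zero: "coeff R B \<zero> z = 0"
  using coeff_add[of \<zero> \<zero> z] by simp

lemma int_zero_multiple: "[(0::int)] \<cdot> r = \<zero>"
  by (simp add: add_pow_def)

lemma coeff_int_multiple:
  fixes k :: int
  assumes r: "r \<in> carrier R"
  shows "coeff R B ([k] \<cdot> r) z = k * coeff R B r z"
proof (induction k rule: int_induct[where k = 0])
  case base
  then show ?case using coeff_zero int_zero_multiple by simp
next
  case (step1 i)
  have "[(i + 1)] \<cdot> r = [i] \<cdot> r \<oplus> r"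
    using r add.int_pow_mult[of r i 1] by simp
  then show ?case using step1 r by (simp add: coeff_add distrib_right)
next
  case (step2 i)
  have "[i] \<cdot> r = [(i - 1)] \<cdot> r \<oplus> r"
    using r add.int_pow_mult[of r "i - 1" 1] by simp
  then have "coeff R B ([i] \<cdot> r) z = coeff R B ([(i - 1)] \<cdot> r) z + coeff R B r z"
    using r coeff_add[of "[(i - 1)] \<cdot> r" r z] by simp
  then show ?case using step2 by (simp add: left_diff_distrib)
qed

lemma coeff_finsum:
  assumes "finite A" "\<And>a. a \<in> A \<Longrightarrow> f a \<in> carrier R"
  shows "coeff R B (\<Oplus>a\<in>A. f a) z = (\<Sum>a\<in>A. coeff R B (f a) z)"
  using assms
proof (induction A)
  case empty
  then show ?case by (simp add: coeff_zero)
next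
  case (insert a A)
  then have "(\<Oplus>a\<in>insert a A. f a) = f a \<oplus> (\<Oplus>a\<in>A. f a)"
    by (intro finsum_insert) auto
  then show ?case using insert by (simp add: coeff_add)
qed

lemma coeff_basis: "x \<in> B \<Longrightarrow> coeff R B x z = (if z = x then 1 else 0)"
proof -
  assume x: "x \<in> B"
  have "(\<Oplus>y\<in>B. [(if y = x then 1 else 0 :: int)] \<cdot> y) = (\<Oplus>y\<in>B. if x = y then y else \<zero>)"
    using basis_closed add.int_pow_1 int_zero_multiple by (intro finsum_cong') auto
  also have "\<dots> = x" using x finite_basis basis_closed by (intro finsum_singleton) auto
  finally have "int_expansion R B x (\<lambda>y. if y = x then 1 else 0)"
    using x by (auto simp: int_expansion_def)
  then show ?thesis using coeff_eqI x basis_closed by simp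
qed

text \<open>With this, arguments about products of basis elements become arguments about integer coefficients.\<close>

lemma coeff_mult_right:
  assumes r: "r \<in> carrier R" and s: "s \<in> carrier R"
  shows "coeff R B (r \<otimes> s) z = (\<Sum>y\<in>B. coeff R B s y * coeff R B (r \<otimes> y) z)"
proof -
  have "r \<otimes> s = r \<otimes> (\<Oplus>y\<in>B. [coeff R B s y] \<cdot> y)" using basis_expansion[OF s] by simp
  also have "\<dots> = (\<Oplus>y\<in>B. r \<otimes> ([coeff R B s y] \<cdot> y))"
    using r finite_basis basis_closed by (intro finsum_rdistr) auto
  also have "\<dots> = (\<Oplus>y\<in>B. [coeff R B s y] \<cdot> (r \<otimes> y))"
    using r basis_closed by (intro finsum_cong') (auto simp: add_pow_rdistr_int)
  finally show ?thesis
    using r basis_closed finite_basis by (simp add: coeff_finsum coeff_int_multiple)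
qed

section \<open>The group of invertible basis elements\<close>

abbreviation G :: "'a set" where
  "G \<equiv> carrier (inv_group R B star)"

lemma G_iff: "g \<in> G \<longleftrightarrow> g \<in> B \<and> g \<otimes> star g = \<one> \<and> star g \<otimes> g = \<one>"
  by (auto simp: inv_group_def)

lemma G_basis: "g \<in> G \<Longrightarrow> g \<in> B"
  by (simp add: G_iff)

lemma star_one: "star \<one> = \<one>"
  using coeff_one[OF one_in_basis one_in_basis] coeff_basis[OF one_in_basis, of \<one>]
  by (auto split: if_splits)

lemma one_in_G: "\<one> \<in> G"
  using one_in_basis by (simp add: G_iff star_one)

lemma star_in_G: "g \<in> G \<Longrightarrow> star g \<in> G"
  by (auto simp: G_iff star_closed star_star)

lemma star_cancel:
  assumes "g \<in> G" "r \<in> carrier R"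
  shows "star g \<otimes> (g \<otimes> r) = r" "g \<otimes> (star g \<otimes> r) = r"
  using assms basis_closed star_closed
  by (simp_all add: G_iff m_assoc[symmetric])

text \<open>Multiplication by \<open>g\<close> permutes the basis. Write \<open>g x\<close> with coefficients \<open>c\<^sub>z \<ge> 0\<close>. Multiplying
back by \<open>g\<^sup>*\<close> expresses the single basis element \<open>x\<close> as a sum of the \<open>c\<^sub>z (g\<^sup>* z)\<close>, all of whose
coefficients are non-negative integers. So nothing can cancel: exactly one \<open>c\<^sub>z\<close> is non-zero, and it
is \<open>1\<close>.\<close>

lemma mult_in_basis:
  assumes g: "g \<in> G" and x: "x \<in> B"
  shows "g \<otimes> x \<in> B"
proof -
  have gc: "g \<in> carrier R" "star g \<in> carrier R" "star g \<in> B" "g \<in> B"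
    using g G_basis star_in_G basis_closed by auto
  have xc: "x \<in> carrier R" using x basis_closed by simp
  define c where "c z = coeff R B (g \<otimes> x) z" for z
  define m where "m z y = coeff R B (star g \<otimes> z) y" for z y
  have c0: "c z \<ge> 0" if "z \<in> B" for z unfolding c_def using nonneg gc x that by simp
  have m0: "m z y \<ge> 0" if "z \<in> B" "y \<in> B" for z y unfolding m_def using nonneg gc that by simp
  have sum: "(\<Sum>z\<in>B. c z * m z y) = (if y = x then 1 else 0)" for y
    using coeff_mult_right[of "star g" "g \<otimes> x" y] star_cancel[OF g xc] gc xc coeff_basis[OF x]
    by (simp add: c_def m_def)
  have "(\<Sum>z\<in>B. c z * m z x) \<noteq> 0" by (simp add: sum)
  then obtain z0 where z0: "z0 \<in> B" "c z0 * m z0 x \<noteq> 0" by (meson sum.neutral)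
  have le: "c z0 * m z0 x + (\<Sum>z\<in>B - {z0}. c z * m z x) = 1"
    using sum[of x] sum.remove[OF finite_basis z0(1), of "\<lambda>z. c z * m z x"] by simp
  \<comment> \<open>As no summand is negative, nothing cancels in the sums over z, which are 1 at y = x and 0 elsewhere.\<close>
  have nn: "0 \<le> c z * m z y" if "z \<in> B" "y \<in> B" for z y using c0 m0 that by simp
  have rest: "(\<Sum>z\<in>B - {z0}. c z * m z x) = 0" and prod1: "c z0 * m z0 x = 1"
    using le z0 nn[OF z0(1) x] sum_nonneg[of "B - {z0}" "\<lambda>z. c z * m z x"] nn x
    by (smt (verit) Diff_iff)+
  have "c z0 = 1" using prod1 c0[OF z0(1)] by (simp add: pos_zmult_eq_1_iff zmult_eq_1_iff)
  moreover have "c z = 0" if z: "z \<noteq> z0" for z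
  proof (cases "z \<in> B")
    case False
    then show ?thesis using coeff_outside gc xc by (simp add: c_def)
  next
    case True
    show ?thesis
    proof (rule ccontr)
      assume cz: "c z \<noteq> 0"
      have "c z * m z x = 0"
        using rest sum_nonneg_eq_0_iff[of "B - {z0}" "\<lambda>z. c z * m z x"] nn x True z finite_basis by auto
      moreover have "c z * m z y = 0" if "y \<in> B" "y \<noteq> x" for y
        using sum[of y] sum_nonneg_eq_0_iff[of B "\<lambda>z. c z * m z y"] nn that True finite_basis by auto
      ultimately have "m z y = 0" if "y \<in> B" for y using cz that by fastforce
      then have "m z y = 0" for y
        using coeff_outside True basis_closed gc by (cases "y \<in> B") (auto simp: m_def)
      \<comment> \<open>All coefficients of this translate of z vanish, but translation by an invertible element is injective.\<close>
      then have "star g \<otimes> z = \<zero>"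
        using True basis_closed gc by (intro coeff_inject) (auto simp: m_def coeff_zero)
      then have "z = \<zero>" using star_cancel(2)[OF g, of z] True basis_closed gc by simp
      then show False using coeff_basis[OF True, of z] coeff_zero by simp
    qed
  qed
  ultimately have "g \<otimes> x = z0"
    using gc xc basis_closed[OF z0(1)] coeff_basis[OF z0(1)]
    by (intro coeff_inject) (auto simp: c_def)
  then show ?thesis using z0 by simp
qed

lemma star_mult:
  assumes "x \<in> B" "y \<in> B" "x \<otimes> y \<in> B"
  shows "star (x \<otimes> y) = star y \<otimes> star x"
  using anti_involution assms basis_closed by metis

lemma mult_in_G:
  assumes g: "g \<in> G" and h: "h \<in> G"
  shows "g \<otimes> h \<in> G"
proof -
  have c: "g \<in> carrier R" "h \<in> carrier R" "star g \<in> carrier R" "star h \<in> carrier R"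
    using g h star_in_G G_basis basis_closed by auto
  have s: "star (g \<otimes> h) = star h \<otimes> star g"
    using star_mult mult_in_basis g h G_basis by simp
  have "g \<otimes> h \<otimes> (star h \<otimes> star g) = g \<otimes> (h \<otimes> (star h \<otimes> star g))"
    "star h \<otimes> star g \<otimes> (g \<otimes> h) = star h \<otimes> (star g \<otimes> (g \<otimes> h))"
    using c by (simp_all add: m_assoc)
  then show ?thesis
    using g h c star_cancel[OF h] star_cancel[OF g] mult_in_basis[OF g G_basis[OF h]] s
    by (simp add: G_iff)
qed

lemma inv_group_simps:
  "monoid.mult (inv_group R B star) = monoid.mult R" "one (inv_group R B star) = one R"
  by (simp_all add: inv_group_def)

lemma group_inv_group: "group (inv_group R B star)"
proof (rule groupI)
  show "\<exists>y\<in>G. y \<otimes>\<^bsub>inv_group R B star\<^esub> x = \<one>\<^bsub>inv_group R B star\<^esub>" if "x \<in> G" for x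
    using that star_in_G[OF that] by (auto simp: inv_group_simps G_iff)
qed (use mult_in_G one_in_G G_basis basis_closed in \<open>auto simp: inv_group_simps m_assoc\<close>)

lemma inv_group_inv: "g \<in> G \<Longrightarrow> inv\<^bsub>inv_group R B star\<^esub> g = star g"
  using group.inv_equality[OF group_inv_group, of "star g" g] star_in_G[of g]
  by (simp add: inv_group_simps G_iff)

lemma finite_G: "finite G"
  using finite_basis G_basis by (meson finite_subset subsetI)

text \<open>The involution turns the left multiplication by \<open>g\<^sup>*\<close> into the right multiplication by \<open>g\<close>.\<close>

lemma mult_in_basis_right:
  assumes x: "x \<in> B" and g: "g \<in> G"
  shows "x \<otimes> g \<in> B"
proof -
  have "star g \<otimes> star x \<in> B" using mult_in_basis star_in_G g star_closed x by simp
  then have "star (star g \<otimes> star x) = x \<otimes> g"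
    using star_mult[of "star g" "star x"] star_closed star_star x g G_basis by simp
  then show ?thesis using \<open>star g \<otimes> star x \<in> B\<close> star_closed by metis
qed

abbreviation X :: "'a set" where
  "X \<equiv> noninv R B star"

lemma noninv_star: "x \<in> X \<Longrightarrow> star x \<in> X"
  using star_closed star_in_G star_star by (metis DiffD1 DiffD2 DiffI)

lemma noninv_mult_left:
  assumes g: "g \<in> G" and x: "x \<in> X"
  shows "g \<otimes> x \<in> X"
proof -
  have "g \<otimes> x \<notin> G"
  proof
    assume "g \<otimes> x \<in> G"
    then have "star g \<otimes> (g \<otimes> x) \<in> G" using mult_in_G star_in_G g by blast
    then show False using star_cancel[OF g, of x] x basis_closed by simp
  qed
  then show ?thesis using mult_in_basis g x by simp
qed

lemma noninv_mult_right:
  assumes x: "x \<in> X" and g: "g \<in> G"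
  shows "x \<otimes> g \<in> X"
proof -
  have c: "x \<in> carrier R" "g \<in> carrier R" "star g \<in> carrier R"
    using x g star_in_G G_basis basis_closed by auto
  have "x \<otimes> g \<notin> G"
  proof
    assume "x \<otimes> g \<in> G"
    then have "x \<otimes> g \<otimes> star g \<in> G" using mult_in_G star_in_G g by blast
    moreover have "x \<otimes> g \<otimes> star g = x" using c g by (simp add: m_assoc G_iff)
    ultimately show False using x by simp
  qed
  then show ?thesis using mult_in_basis_right g x by simp
qed

text \<open>Translating by \<open>g\<^sup>*\<close> moves the coefficient at \<open>g\<close> to the coefficient at the unit, which is given by
the duality axiom of a fusion ring.\<close>

lemma coeff_group_element:
  assumes x: "x \<in> B" and y: "y \<in> B" and g: "g \<in> G"
  shows "coeff R B (x \<otimes> y) g = (if g \<otimes> star y = x then 1 else 0)"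
proof -
  have c: "x \<in> carrier R" "y \<in> carrier R" "g \<in> carrier R" "star g \<in> carrier R" "star y \<in> carrier R"
    using x y g star_in_G G_basis star_closed basis_closed by auto
  have "coeff R B (star g \<otimes> (x \<otimes> y)) \<one> = (\<Sum>z\<in>B. coeff R B (x \<otimes> y) z * coeff R B (star g \<otimes> z) \<one>)"
    using c by (intro coeff_mult_right) auto
  \<comment> \<open>By duality only z = g contributes to the coefficient at the unit.\<close>
  also have "\<dots> = (\<Sum>z\<in>B. if z = g then coeff R B (x \<otimes> y) z else 0)"
  proof (rule sum.cong)
    fix z assume "z \<in> B"
    then show "coeff R B (x \<otimes> y) z * coeff R B (star g \<otimes> z) \<one> = (if z = g then coeff R B (x \<otimes> y) z else 0)"
      using coeff_one[of "star g" z] g star_closed G_basis star_star[of g] star_star[of z] by auto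
  qed simp
  also have "\<dots> = coeff R B (x \<otimes> y) g" using G_basis[OF g] finite_basis by simp
  finally have "coeff R B (x \<otimes> y) g = coeff R B (star g \<otimes> x \<otimes> y) \<one>"
    using c by (simp add: m_assoc)
  also have "\<dots> = (if star g \<otimes> x = star y then 1 else 0)"
    using mult_in_basis[OF star_in_G[OF g] x] y by (rule coeff_one)
  also have "star g \<otimes> x = star y \<longleftrightarrow> g \<otimes> star y = x"
    using star_cancel[OF g] c by metis
  finally show ?thesis .
qed

end

section \<open>Fusion rings with two orbits\<close>

locale two_orbit_fusion_ring = fusion_ring +
  assumes two_orbits: "card (basis_orbits R B star) = 2"
begin

lemma orbit_eq: "x \<in> B \<Longrightarrow> orbit (inv_group R B star) (left_action R B) x = (\<lambda>g. g \<otimes> x) ` G"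
  by (auto simp: orbit_def left_action_def)

lemma mem_orbit: "x \<in> B \<Longrightarrow> x \<in> orbit (inv_group R B star) (left_action R B) x"
  using one_in_G basis_closed by (auto simp: orbit_eq intro!: image_eqI[of _ _ \<one>])

lemma orbit_one: "orbit (inv_group R B star) (left_action R B) \<one> = G"
  using G_basis basis_closed one_in_basis by (force simp: orbit_eq)

lemma basis_orbits_eq:
  "basis_orbits R B star = orbit (inv_group R B star) (left_action R B) ` B"
  by (auto simp: basis_orbits_def orbits_def)

lemma noninv_nonempty: "X \<noteq> {}"
proof
  assume "X = {}"
  then have BG: "B \<subseteq> G" by auto
  have "orbit (inv_group R B star) (left_action R B) x = G" if x: "x \<in> B" for x
  proof -
    have xG: "x \<in> G" using x BG by auto
    have "g \<in> (\<lambda>g. g \<otimes> x) ` G" if g: "g \<in> G" for g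
    proof (rule image_eqI[of _ _ "g \<otimes> star x"])
      show "g = g \<otimes> star x \<otimes> x"
        using xG g star_in_G[OF xG] G_basis basis_closed by (simp add: m_assoc G_iff)
    qed (use mult_in_G g star_in_G xG in auto)
    then show ?thesis using mult_in_G xG by (auto simp: orbit_eq[OF x])
  qed
  then have "basis_orbits R B star \<subseteq> {G}" by (auto simp: basis_orbits_eq)
  then have "card (basis_orbits R B star) \<le> 1" using card_mono[of "{G}"] by simp
  then show False using two_orbits by simp
qed

text \<open>The unit has the orbit \<open>G\<close>, so with two orbits in total there is only one left for \<open>X\<close>.\<close>

lemma noninv_transitive:
  assumes x: "x \<in> X" and y: "y \<in> X"
  obtains g where "g \<in> G" "y = g \<otimes> x"
proof -
  let ?o = "orbit (inv_group R B star) (left_action R B)"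
  have ne: "?o z \<noteq> G" if "z \<in> X" for z using mem_orbit[of z] that by auto
  have "?o x = ?o y"
  proof (rule ccontr)
    assume "?o x \<noteq> ?o y"
    \<comment> \<open>Otherwise the unit, x and y would lie in three different orbits.\<close>
    then have "card {?o \<one>, ?o x, ?o y} = 3" using ne[OF x] ne[OF y] by (auto simp: orbit_one)
    moreover have "{?o \<one>, ?o x, ?o y} \<subseteq> basis_orbits R B star"
      using x y one_in_basis by (auto simp: basis_orbits_eq)
    then have "card {?o \<one>, ?o x, ?o y} \<le> 2"
      using card_mono[of "basis_orbits R B star"] finite_basis two_orbits by (simp add: basis_orbits_eq)
    ultimately show False by simp
  qed
  then have "y \<in> ?o x" using mem_orbit y by auto
  then show ?thesis using that x by (auto simp: orbit_eq)
qed

lemma stabilizer_eq: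
  "x \<in> B \<Longrightarrow> stabilizer (inv_group R B star) (left_action R B) x = {g \<in> G. g \<otimes> x = x}"
  by (simp add: stabilizer_def left_action_def)

text \<open>The left stabilizers of \<open>x\<close> and \<open>x g\<close> coincide, and by applying the involution to a left translate
of \<open>x\<^sup>*\<close> every element of \<open>X\<close> is seen to be a right translate of \<open>x\<close>.\<close>

lemma stabilizers_agree:
  assumes x: "x \<in> X" and y: "y \<in> X"
  shows "{g \<in> G. g \<otimes> x = x} = {g \<in> G. g \<otimes> y = y}"
proof -
  obtain g where g: "g \<in> G" "star y = g \<otimes> star x"
    using noninv_transitive[OF noninv_star[OF x] noninv_star[OF y]] .
  have c: "x \<in> carrier R" "g \<in> carrier R" "star g \<in> carrier R"
    using x g star_in_G G_basis basis_closed by auto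
  \<comment> \<open>Applying the involution turns y into the right translate of x by the inverse of g.\<close>
  have "y = star (g \<otimes> star x)" using g star_star[of y] y by simp
  then have yx: "y = x \<otimes> star g"
    using star_mult[of g "star x"] mult_in_basis[OF g(1)] star_closed[of x] star_star[of x] x G_basis[OF g(1)] by simp
  have xy: "x = y \<otimes> g" using yx c g by (simp add: m_assoc G_iff)
  have "h \<otimes> y = y" if "h \<in> G" "h \<otimes> x = x" for h
    using that c G_basis basis_closed by (simp add: yx m_assoc[symmetric])
  moreover have "h \<otimes> x = x" if "h \<in> G" "h \<otimes> y = y" for h
  proof -
    have "h \<otimes> x = h \<otimes> y \<otimes> g"
      using xy c that y G_basis basis_closed m_assoc[of h y g] by simp
    then show ?thesis using that xy by simp
  qed
  ultimately show ?thesis by auto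
qed

text \<open>The definition of the stabilizer as the unique set with a property is meaningful because \<open>X\<close> is not
empty and all its elements have the same stabilizer.\<close>

lemma stab_group_eq:
  assumes x: "x \<in> X"
  shows "stab_group R B star = {g \<in> G. g \<otimes> x = x}"
  unfolding stab_group_def
proof (rule the_equality)
  show "\<forall>y\<in>X. stabilizer (inv_group R B star) (left_action R B) y = {g \<in> G. g \<otimes> x = x}"
    using stabilizers_agree[OF _ x] by (simp add: stabilizer_eq)
  fix H assume "\<forall>y\<in>X. stabilizer (inv_group R B star) (left_action R B) y = H"
  then show "H = {g \<in> G. g \<otimes> x = x}" using x by (auto simp: stabilizer_eq)
qed

abbreviation H :: "'a set" where
  "H \<equiv> stab_group R B star"

lemma subgroup_H: "subgroup H (inv_group R B star)"
proof -
  obtain x where x: "x \<in> X" using noninv_nonempty by auto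
  then have xc: "x \<in> carrier R" using basis_closed by simp
  show ?thesis unfolding stab_group_eq[OF x]
  proof (rule group.subgroupI[OF group_inv_group])
    show "{g \<in> G. g \<otimes> x = x} \<noteq> {}" using one_in_G xc by auto
    show "inv\<^bsub>inv_group R B star\<^esub> a \<in> {g \<in> G. g \<otimes> x = x}" if "a \<in> {g \<in> G. g \<otimes> x = x}" for a
      using that star_cancel(1)[of a x] xc star_in_G by (simp add: inv_group_inv)
    show "a \<otimes>\<^bsub>inv_group R B star\<^esub> b \<in> {g \<in> G. g \<otimes> x = x}"
      if "a \<in> {g \<in> G. g \<otimes> x = x}" "b \<in> {g \<in> G. g \<otimes> x = x}" for a b
      using that mult_in_G xc G_basis basis_closed by (simp add: inv_group_simps m_assoc)
  qed auto
qed

text \<open>If \<open>g\<close> and \<open>k\<close> move \<open>x\<close> to the same place, then \<open>k\<inverse> g\<close> fixes \<open>x\<close>.\<close>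

lemma transporter_eq_coset:
  assumes x: "x \<in> X" and k: "k \<in> G"
  shows "{g \<in> G. g \<otimes> x = k \<otimes> x} = (\<lambda>h. k \<otimes> h) ` H"
proof -
  have c: "x \<in> carrier R" "k \<in> carrier R" "star k \<in> carrier R"
    using x k star_in_G G_basis basis_closed by auto
  have "g \<in> (\<lambda>h. k \<otimes> h) ` {g \<in> G. g \<otimes> x = x}" if g: "g \<in> G" "g \<otimes> x = k \<otimes> x" for g
  proof (rule image_eqI[of _ _ "star k \<otimes> g"])
    have gc: "g \<in> carrier R" using g G_basis basis_closed by auto
    show "g = k \<otimes> (star k \<otimes> g)" using star_cancel[OF k gc] by simp
    show "star k \<otimes> g \<in> {g \<in> G. g \<otimes> x = x}"
      using g gc c k star_cancel[OF k] mult_in_G star_in_G by (simp add: m_assoc)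
  qed
  moreover have "k \<otimes> h \<in> {g \<in> G. g \<otimes> x = k \<otimes> x}" if "h \<in> G" "h \<otimes> x = x" for h
    using that k mult_in_G c G_basis basis_closed by (simp add: m_assoc)
  ultimately show ?thesis unfolding stab_group_eq[OF x] by auto
qed

end

section \<open>Bijections between quotients\<close>

text \<open>Two maps that respect equivalence relations and are inverse to each other up to equivalence induce a
bijection of the classes. The predicates cut out the parts of the two sets where the maps are
defined; they are constant on classes.\<close>

lemma bij_betw_quotients:
  assumes r: "equiv X r" and s: "equiv Y s"
    and P: "\<And>x x'. \<lbrakk>(x, x') \<in> r; P x\<rbrakk> \<Longrightarrow> P x'" and Q: "\<And>y y'. \<lbrakk>(y, y') \<in> s; Q y\<rbrakk> \<Longrightarrow> Q y'"
    and f: "\<And>x. \<lbrakk>x \<in> X; P x\<rbrakk> \<Longrightarrow> f x \<in> Y \<and> Q (f x)"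
    and g: "\<And>y. \<lbrakk>y \<in> Y; Q y\<rbrakk> \<Longrightarrow> g y \<in> X \<and> P (g y)"
    and f_cong: "\<And>x x'. \<lbrakk>(x, x') \<in> r; P x; P x'\<rbrakk> \<Longrightarrow> (f x, f x') \<in> s"
    and g_cong: "\<And>y y'. \<lbrakk>(y, y') \<in> s; Q y; Q y'\<rbrakk> \<Longrightarrow> (g y, g y') \<in> r"
    and gf: "\<And>x. \<lbrakk>x \<in> X; P x\<rbrakk> \<Longrightarrow> (x, g (f x)) \<in> r"
    and fg: "\<And>y. \<lbrakk>y \<in> Y; Q y\<rbrakk> \<Longrightarrow> (y, f (g y)) \<in> s"
  shows "bij_betw (\<lambda>C. s `` (f ` C)) {C \<in> X // r. \<forall>x\<in>C. P x} {D \<in> Y // s. \<forall>y\<in>D. Q y}"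
proof -
  have F: "s `` (f ` (r `` {x})) = s `` {f x}" if x: "x \<in> X" "P x" for x
  proof
    show "s `` (f ` (r `` {x})) \<subseteq> s `` {f x}"
      using f_cong P x s unfolding equiv_def by (blast dest: transD)
    show "s `` {f x} \<subseteq> s `` (f ` (r `` {x}))"
      using equiv_class_self[OF r x(1)] by auto
  qed
  have G: "r `` (g ` (s `` {y})) = r `` {g y}" if y: "y \<in> Y" "Q y" for y
  proof
    show "r `` (g ` (s `` {y})) \<subseteq> r `` {g y}"
      using g_cong Q y r unfolding equiv_def by (blast dest: transD)
    show "r `` {g y} \<subseteq> r `` (g ` (s `` {y}))"
      using equiv_class_self[OF s y(1)] by auto
  qed
  have 1: "s `` (f ` C) \<in> {D \<in> Y // s. \<forall>y\<in>D. Q y} \<and> r `` (g ` (s `` (f ` C))) = C"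
    if C: "C \<in> {C \<in> X // r. \<forall>x\<in>C. P x}" for C
  proof -
    obtain x where x: "C = r `` {x}" "x \<in> X" using C by (auto elim!: quotientE)
    then have "P x" using C equiv_class_self[OF r] by auto
    note x = x this
    have fx: "f x \<in> Y" "Q (f x)" using f x by auto
    show ?thesis using fx Q F[OF x(2,3)] G[OF fx] equiv_class_eq[OF r gf[OF x(2,3)]] x(1)
      by (auto intro: quotientI)
  qed
  have 2: "r `` (g ` D) \<in> {C \<in> X // r. \<forall>x\<in>C. P x} \<and> s `` (f ` (r `` (g ` D))) = D"
    if D: "D \<in> {D \<in> Y // s. \<forall>y\<in>D. Q y}" for D
  proof -
    obtain y where y: "D = s `` {y}" "y \<in> Y" using D by (auto elim!: quotientE)
    then have "Q y" using D equiv_class_self[OF s] by auto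
    note y = y this
    have gy: "g y \<in> X" "P (g y)" using g y by auto
    show ?thesis using gy P G[OF y(2,3)] F[OF gy] equiv_class_eq[OF s fg[OF y(2,3)]] y(1)
      by (auto intro: quotientI)
  qed
  show ?thesis
    by (intro bij_betw_byWitness[where f' = "\<lambda>D. r `` (g ` D)"] ballI image_subsetI
        conjunct1[OF 1] conjunct2[OF 1] conjunct1[OF 2] conjunct2[OF 2])
qed

section \<open>The complexified fusion ring\<close>

lemma algebra_repD:
  assumes "algebra_rep A \<psi>"
  shows algebra_rep_carrier: "f \<in> carrier A \<Longrightarrow> snd \<psi> f \<in> carrier_mat (fst \<psi>) (fst \<psi>)"
    and algebra_rep_mult: "\<lbrakk>f \<in> carrier A; g \<in> carrier A\<rbrakk> \<Longrightarrow> snd \<psi> (f \<otimes>\<^bsub>A\<^esub> g) = snd \<psi> f * snd \<psi> g"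
    and algebra_rep_add: "\<lbrakk>f \<in> carrier A; g \<in> carrier A\<rbrakk> \<Longrightarrow> snd \<psi> (f \<oplus>\<^bsub>A\<^esub> g) = snd \<psi> f + snd \<psi> g"
    and algebra_rep_one: "snd \<psi> \<one>\<^bsub>A\<^esub> = 1\<^sub>m (fst \<psi>)"
    and algebra_rep_smult: "f \<in> carrier A \<Longrightarrow> snd \<psi> (c \<odot>\<^bsub>A\<^esub> f) = c \<cdot>\<^sub>m snd \<psi> f"
  using assms by (auto simp: algebra_rep_def ring_mat_simps Ring.ring_hom_def)

context fusion_ring
begin

abbreviation A :: "(complex, 'a \<Rightarrow> complex) module" where
  "A \<equiv> complexification R B"

lemma complexification_simps:
  "carrier A = {f. \<forall>x. x \<notin> B \<longrightarrow> f x = 0}"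
  "f \<otimes>\<^bsub>A\<^esub> g = (\<lambda>z. \<Sum>x\<in>B. \<Sum>y\<in>B. f x * g y * of_int (coeff R B (x \<otimes> y) z))"
  "\<one>\<^bsub>A\<^esub> = to_complex R B \<one>" "\<zero>\<^bsub>A\<^esub> = (\<lambda>_. 0)" "f \<oplus>\<^bsub>A\<^esub> g = (\<lambda>z. f z + g z)"
  "c \<odot>\<^bsub>A\<^esub> f = (\<lambda>z. c * f z)"
  by (simp_all add: complexification_def)

lemma to_complex_closed: "r \<in> carrier R \<Longrightarrow> to_complex R B r \<in> carrier A"
  by (simp add: complexification_simps to_complex_def coeff_outside)

lemma to_complex_basis: "x \<in> B \<Longrightarrow> to_complex R B x = (\<lambda>z. if z = x then 1 else 0)"
  by (auto simp: to_complex_def coeff_basis)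

lemma to_complex_mult:
  assumes "x \<in> B" "y \<in> B"
  shows "to_complex R B x \<otimes>\<^bsub>A\<^esub> to_complex R B y = to_complex R B (x \<otimes> y)"
proof
  fix z
  let ?\<delta> = "\<lambda>a b. if a = b then 1 else (0::complex)"
  have \<delta>: "?\<delta> a b * t = (if a = b then t else 0)" for a b :: 'a and t by simp
  have "(to_complex R B x \<otimes>\<^bsub>A\<^esub> to_complex R B y) z =
    (\<Sum>a\<in>B. ?\<delta> a x * (\<Sum>b\<in>B. ?\<delta> b y * of_int (coeff R B (a \<otimes> b) z)))"
    unfolding complexification_simps to_complex_basis[OF assms(1)] to_complex_basis[OF assms(2)]
      sum_distrib_left mult.assoc ..
  also have "\<dots> = to_complex R B (x \<otimes> y) z"
    using assms finite_basis unfolding \<delta> by (simp add: to_complex_def)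
  finally show "(to_complex R B x \<otimes>\<^bsub>A\<^esub> to_complex R B y) z = to_complex R B (x \<otimes> y) z" .
qed

lemma abelian_monoid_complexification: "abelian_monoid A"
proof (rule abelian_monoidI)
  fix f g h :: "'a \<Rightarrow> complex"
  show "f \<oplus>\<^bsub>A\<^esub> g \<oplus>\<^bsub>A\<^esub> h = f \<oplus>\<^bsub>A\<^esub> (g \<oplus>\<^bsub>A\<^esub> h)"
    unfolding complexification_simps by (intro ext add.assoc)
  show "f \<oplus>\<^bsub>A\<^esub> g = g \<oplus>\<^bsub>A\<^esub> f"
    unfolding complexification_simps by (intro ext add.commute)
qed (simp_all add: complexification_simps)

lemma finsum_complexification:
  assumes "finite S" "\<And>s. s \<in> S \<Longrightarrow> f s \<in> carrier A"
  shows "finsum A f S = (\<lambda>z. \<Sum>s\<in>S. f s z)"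
proof -
  interpret A: abelian_monoid A by (rule abelian_monoid_complexification)
  show ?thesis using assms
  proof (induction S)
    case empty
    then show ?case by (simp add: complexification_simps)
  next
    case (insert s S)
    then have "finsum A f (insert s S) = f s \<oplus>\<^bsub>A\<^esub> finsum A f S"
      by (intro A.finsum_insert) auto
    then show ?case using insert by (simp add: complexification_simps)
  qed
qed

text \<open>The images of the basis elements span the complexification. As its elements are functions, linearity
has to be unfolded by an induction over the support.\<close>

lemma algebra_rep_expansion:
  assumes \<psi>: "algebra_rep A \<psi>" and f: "f \<in> carrier A"
  shows "snd \<psi> f = msum (fst \<psi>) (fst \<psi>) (\<lambda>x. f x \<cdot>\<^sub>m snd \<psi> (to_complex R B x)) B"
proof -
  let ?n = "fst \<psi>"
  have tc: "snd \<psi> (to_complex R B x) \<in> carrier_mat ?n ?n" if "x \<in> B" for x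
    using algebra_rep_carrier[OF \<psi> to_complex_closed] basis_closed that by simp
  have "snd \<psi> (\<lambda>z. if z \<in> S then f z else 0) = msum ?n ?n (\<lambda>x. f x \<cdot>\<^sub>m snd \<psi> (to_complex R B x)) S"
    if "finite S" "S \<subseteq> B" for S
    using that
  proof (induction S)
    case empty
    have "f \<in> carrier A \<Longrightarrow> snd \<psi> (0 \<odot>\<^bsub>A\<^esub> f) = 0 \<cdot>\<^sub>m snd \<psi> f"
      by (rule algebra_rep_smult[OF \<psi>])
    then have "snd \<psi> (\<lambda>_. 0) = 0 \<cdot>\<^sub>m snd \<psi> f" using f by (simp add: complexification_simps)
    also have "\<dots> = 0\<^sub>m ?n ?n" using algebra_rep_carrier[OF \<psi> f] by (intro eq_matI) auto
    finally show ?case by (simp add: msum_empty)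
  next
    case (insert x S)
    let ?fS = "\<lambda>z. if z \<in> S then f z else 0"
    have x: "x \<in> B" using insert by simp
    have fS: "?fS \<in> carrier A" using insert by (auto simp: complexification_simps)
    have tx: "to_complex R B x \<in> carrier A" using to_complex_closed basis_closed x by simp
    then have ftx: "f x \<odot>\<^bsub>A\<^esub> to_complex R B x \<in> carrier A" by (simp add: complexification_simps)
    have "(\<lambda>z. if z \<in> insert x S then f z else 0) = (f x \<odot>\<^bsub>A\<^esub> to_complex R B x) \<oplus>\<^bsub>A\<^esub> ?fS"
      using insert x by (auto simp: complexification_simps to_complex_basis)
    then have "snd \<psi> (\<lambda>z. if z \<in> insert x S then f z else 0) =
      f x \<cdot>\<^sub>m snd \<psi> (to_complex R B x) + snd \<psi> ?fS"
      using algebra_rep_add[OF \<psi> ftx fS] algebra_rep_smult[OF \<psi> tx] by simp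
    then show ?case using insert tc[OF x] by (simp add: msum_insert)
  qed
  from this[OF finite_basis] have "snd \<psi> (\<lambda>z. if z \<in> B then f z else 0) =
    msum ?n ?n (\<lambda>x. f x \<cdot>\<^sub>m snd \<psi> (to_complex R B x)) B" by simp
  moreover have "(\<lambda>z. if z \<in> B then f z else 0) = f" using f by (auto simp: complexification_simps)
  ultimately show ?thesis by simp
qed

section \<open>Restriction to the invertible elements and extension by zero\<close>

definition vanishes_on_noninv :: "('a \<Rightarrow> complex) mrep \<Rightarrow> bool" where
  "vanishes_on_noninv \<psi> \<longleftrightarrow> (\<forall>x\<in>X. snd \<psi> (to_complex R B x) = 0\<^sub>m (fst \<psi>) (fst \<psi>))"

definition restrict_rep :: "('a \<Rightarrow> complex) mrep \<Rightarrow> 'a mrep" where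
  "restrict_rep \<psi> = (fst \<psi>, \<lambda>g. snd \<psi> (to_complex R B g))"

definition extend_rep :: "'a mrep \<Rightarrow> ('a \<Rightarrow> complex) mrep" where
  "extend_rep \<rho> = (fst \<rho>, \<lambda>f. msum (fst \<rho>) (fst \<rho>) (\<lambda>g. f g \<cdot>\<^sub>m snd \<rho> g) G)"

lemma fst_restrict_rep [simp]: "fst (restrict_rep \<psi>) = fst \<psi>"
  by (simp add: restrict_rep_def)

lemma fst_extend_rep [simp]: "fst (extend_rep \<rho>) = fst \<rho>"
  by (simp add: extend_rep_def)

lemma extend_rep_carrier: "snd (extend_rep \<rho>) f \<in> carrier_mat (fst \<rho>) (fst \<rho>)"
  by (simp add: extend_rep_def)

lemma extend_rep_index:
  assumes "group_rep (inv_group R B star) \<rho>" "i < fst \<rho>" "j < fst \<rho>"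
  shows "snd (extend_rep \<rho>) f $$ (i, j) = (\<Sum>g\<in>G. f g * snd \<rho> g $$ (i, j))"
  unfolding extend_rep_def using assms(2,3)
    index_smult_mat_carrier[OF group_rep_carrier[OF group_inv_group assms(1)] assms(2,3)]
  by (auto intro!: sum.cong)

lemma group_rep_restrict_rep:
  assumes \<psi>: "algebra_rep A \<psi>"
  shows "group_rep (inv_group R B star) (restrict_rep \<psi>)"
proof -
  have tc: "to_complex R B g \<in> carrier A" if "g \<in> G" for g
    using that to_complex_closed basis_closed G_basis by simp
  then show ?thesis
    using algebra_repD[OF \<psi>] G_basis
    by (auto simp: group_rep_iff[OF group_inv_group] restrict_rep_def inv_group_simps
        complexification_simps(3)[symmetric] to_complex_mult[symmetric])
qed

lemma extend_restrict_rep: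
  assumes \<psi>: "algebra_rep A \<psi>" and zero: "vanishes_on_noninv \<psi>" and f: "f \<in> carrier A"
  shows "snd (extend_rep (restrict_rep \<psi>)) f = snd \<psi> f"
proof (rule eq_matI)
  let ?n = "fst \<psi>"
  have tc: "snd \<psi> (to_complex R B x) \<in> carrier_mat ?n ?n" if "x \<in> B" for x
    using algebra_rep_carrier[OF \<psi> to_complex_closed] basis_closed that by simp
  fix i j assume "i < dim_row (snd \<psi> f)" "j < dim_col (snd \<psi> f)"
  then have ij: "i < ?n" "j < ?n" using algebra_rep_carrier[OF \<psi> f] by auto
  have "snd \<psi> f $$ (i, j) = (\<Sum>x\<in>B. f x * snd \<psi> (to_complex R B x) $$ (i, j))"
    unfolding algebra_rep_expansion[OF \<psi> f] using ij index_smult_mat_carrier[OF tc ij]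
    by (auto intro!: sum.cong)
  also have "\<dots> = (\<Sum>x\<in>G. f x * snd \<psi> (to_complex R B x) $$ (i, j))"
    using finite_basis G_basis zero ij
    by (intro sum.mono_neutral_right) (auto simp: vanishes_on_noninv_def)
  also have "\<dots> = snd (extend_rep (restrict_rep \<psi>)) f $$ (i, j)"
    using ij group_rep_restrict_rep[OF \<psi>] by (simp add: extend_rep_index) (simp add: restrict_rep_def)
  finally show "snd (extend_rep (restrict_rep \<psi>)) f $$ (i, j) = snd \<psi> f $$ (i, j)" by simp
qed (use algebra_rep_carrier[OF \<psi> f] extend_rep_carrier[of "restrict_rep \<psi>" f] in auto)

lemma extend_rep_to_complex:
  assumes \<rho>: "group_rep (inv_group R B star) \<rho>" and x: "x \<in> B"
  shows "snd (extend_rep \<rho>) (to_complex R B x) = (if x \<in> G then snd \<rho> x else 0\<^sub>m (fst \<rho>) (fst \<rho>))"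
proof (rule eq_matI)
  let ?M = "if x \<in> G then snd \<rho> x else 0\<^sub>m (fst \<rho>) (fst \<rho>)"
  have M: "?M \<in> carrier_mat (fst \<rho>) (fst \<rho>)"
    using group_rep_carrier[OF group_inv_group \<rho>] by auto
  fix i j assume "i < dim_row ?M" "j < dim_col ?M"
  then have ij: "i < fst \<rho>" "j < fst \<rho>" using M by auto
  have "snd (extend_rep \<rho>) (to_complex R B x) $$ (i, j) =
    (\<Sum>g\<in>G. if g = x then snd \<rho> g $$ (i, j) else 0)"
    using x by (auto simp: extend_rep_index[OF \<rho> ij] to_complex_basis intro!: sum.cong)
  then show "snd (extend_rep \<rho>) (to_complex R B x) $$ (i, j) = ?M $$ (i, j)"
    using finite_G ij by simp
qed (use group_rep_carrier[OF group_inv_group \<rho>, THEN carrier_matD(1)]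
      group_rep_carrier[OF group_inv_group \<rho>, THEN carrier_matD(2)] in
      \<open>simp_all add: extend_rep_def\<close>)

text \<open>Every operator in the image of the extension is a linear combination of the operators of the group, so
both have the same invariant subspaces.\<close>

lemma irreducible_on_extend_rep:
  assumes \<rho>: "group_rep (inv_group R B star) \<rho>"
  shows "irreducible_on (carrier A) (extend_rep \<rho>) \<longleftrightarrow> irreducible_on G \<rho>"
proof -
  let ?n = "fst \<rho>"
  have car: "snd \<rho> g \<in> carrier_mat ?n ?n" if "g \<in> G" for g
    using group_rep_carrier[OF group_inv_group \<rho> that] .
  have inv: "(\<forall>f\<in>carrier A. \<forall>w\<in>W. snd (extend_rep \<rho>) f *\<^sub>v w \<in> W) \<longleftrightarrow>
      (\<forall>g\<in>G. \<forall>w\<in>W. snd \<rho> g *\<^sub>v w \<in> W)" if W: "subspace_of ?n W" for W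
  proof (intro iffI ballI)
    fix g w assume a: "\<forall>f\<in>carrier A. \<forall>w\<in>W. snd (extend_rep \<rho>) f *\<^sub>v w \<in> W" and g: "g \<in> G" and w: "w \<in> W"
    have "to_complex R B g \<in> carrier A" using to_complex_closed basis_closed G_basis g by simp
    then have "snd (extend_rep \<rho>) (to_complex R B g) *\<^sub>v w \<in> W" using a w by blast
    then show "snd \<rho> g *\<^sub>v w \<in> W" using extend_rep_to_complex[OF \<rho>] g G_basis by simp
  next
    fix f w assume a: "\<forall>g\<in>G. \<forall>w\<in>W. snd \<rho> g *\<^sub>v w \<in> W" and w: "w \<in> W"
    have wc: "w \<in> carrier_vec ?n" using w W by (auto simp: subspace_of_iff)
    have "snd (extend_rep \<rho>) f *\<^sub>v w = vec ?n (\<lambda>i. \<Sum>g\<in>G. (f g \<cdot>\<^sub>v (snd \<rho> g *\<^sub>v w)) $ i)"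
    proof (rule eq_vecI)
      fix i assume "i < dim_vec (vec ?n (\<lambda>i. \<Sum>g\<in>G. (f g \<cdot>\<^sub>v (snd \<rho> g *\<^sub>v w)) $ i))"
      then have i: "i < ?n" by simp
      have "(snd (extend_rep \<rho>) f *\<^sub>v w) $ i = (\<Sum>j\<in>{0..<?n}. (\<Sum>g\<in>G. f g * snd \<rho> g $$ (i, j)) * w $ j)"
        using i wc extend_rep_carrier[of \<rho> f] extend_rep_index[OF \<rho> i]
        by (auto simp: scalar_prod_def intro!: sum.cong)
      also have "\<dots> = (\<Sum>g\<in>G. \<Sum>j\<in>{0..<?n}. f g * (snd \<rho> g $$ (i, j) * w $ j))"
        unfolding sum_distrib_right by (subst sum.swap) (simp add: mult.assoc)
      also have "\<dots> = (\<Sum>g\<in>G. (f g \<cdot>\<^sub>v (snd \<rho> g *\<^sub>v w)) $ i)"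
      proof (rule sum.cong)
        fix g assume "g \<in> G"
        then show "(\<Sum>j\<in>{0..<?n}. f g * (snd \<rho> g $$ (i, j) * w $ j)) = (f g \<cdot>\<^sub>v (snd \<rho> g *\<^sub>v w)) $ i"
          using car[of g] i wc by (auto simp: scalar_prod_def sum_distrib_left intro!: sum.cong)
      qed simp
      finally show "(snd (extend_rep \<rho>) f *\<^sub>v w) $ i = vec ?n (\<lambda>i. \<Sum>g\<in>G. (f g \<cdot>\<^sub>v (snd \<rho> g *\<^sub>v w)) $ i) $ i"
        using i by simp
    qed (use extend_rep_carrier[of \<rho> f] in auto)
    also have "\<dots> \<in> W"
      by (rule subspace_of_sum[OF W finite_G]) (use a w W in \<open>auto simp: subspace_of_iff\<close>)
    finally show "snd (extend_rep \<rho>) f *\<^sub>v w \<in> W" .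
  qed
  then show ?thesis unfolding irreducible_on_def fst_extend_rep by blast
qed

lemma rep_iso_on_extend_rep:
  assumes \<rho>: "group_rep (inv_group R B star) \<rho>" and \<sigma>: "group_rep (inv_group R B star) \<sigma>"
    and iso: "rep_iso_on G \<rho> \<sigma>"
  shows "rep_iso_on (carrier A) (extend_rep \<rho>) (extend_rep \<sigma>)"
proof -
  let ?n = "fst \<rho>"
  have n: "fst \<sigma> = ?n" using iso by (simp add: rep_iso_on_def)
  obtain P Q where w: "\<And>g. g \<in> G \<Longrightarrow> similar_mat_wit (snd \<rho> g) (snd \<sigma> g) P Q"
    using iso by (auto simp: rep_iso_on_def)
  have c\<rho>: "snd \<rho> g \<in> carrier_mat ?n ?n" and c\<sigma>: "snd \<sigma> g \<in> carrier_mat ?n ?n" if "g \<in> G" for g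
    using group_rep_carrier[OF group_inv_group \<rho> that] group_rep_carrier[OF group_inv_group \<sigma> that] n
    by simp_all
  note D = similar_mat_witD2[OF c\<rho> w]
  note D1 = D[OF one_in_G one_in_G]
  have comm: "snd \<rho> g * P = P * snd \<sigma> g" if g: "g \<in> G" for g
  proof -
    have "snd \<rho> g * P = P * snd \<sigma> g * Q * P" using D(3)[OF g g] by simp
    also have "\<dots> = P * snd \<sigma> g * (Q * P)"
      by (rule assoc_mult_mat[OF mult_carrier_mat[OF D1(6) c\<sigma>[OF g]] D1(7,6)])
    also have "\<dots> = P * snd \<sigma> g" using D1 c\<sigma>[OF g] by simp
    finally show ?thesis .
  qed
  show ?thesis
  proof (rule rep_iso_onI[where P = P and Q = Q])
    fix f assume "f \<in> carrier A"
    have "snd (extend_rep \<rho>) f * P = msum ?n ?n (\<lambda>g. (f g \<cdot>\<^sub>m snd \<rho> g) * P) G"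
      unfolding extend_rep_def snd_conv using c\<rho> by (intro msum_mult D1) auto
    also have "\<dots> = msum ?n ?n (\<lambda>g. P * (f g \<cdot>\<^sub>m snd \<sigma> g)) G"
      using mult_smult_assoc_mat[OF c\<rho> D1(6)] mult_smult_distrib[OF D1(6) c\<sigma>] comm
      by (intro msum_cong) simp
    also have "\<dots> = P * snd (extend_rep \<sigma>) f"
      unfolding extend_rep_def snd_conv n using c\<sigma> by (intro mult_msum[symmetric] D1) auto
    finally show "snd (extend_rep \<rho>) f * P = P * snd (extend_rep \<sigma>) f" .
  qed (use D1 n extend_rep_carrier[of \<rho>] extend_rep_carrier[of \<sigma>] in auto)
qed

lemma rep_iso_on_restrict_rep:
  "rep_iso_on (carrier A) \<psi> \<phi> \<Longrightarrow> rep_iso_on G (restrict_rep \<psi>) (restrict_rep \<phi>)"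
  unfolding rep_iso_on_def restrict_rep_def
  using to_complex_closed basis_closed G_basis by auto metis

end

section \<open>Multiplicativity of the extension by zero\<close>

context two_orbit_fusion_ring
begin

lemma H_subset: "H \<subseteq> G"
  using subgroup.subset[OF subgroup_H] .

text \<open>The value of the extension by zero on \<open>x y\<close>. In the only interesting case, where both factors are
in \<open>X\<close>, it is a sum over a coset of \<open>H\<close>, which vanishes with the sum over \<open>H\<close> itself.\<close>

lemma sum_structure_constants:
  assumes \<rho>: "group_rep (inv_group R B star) \<rho>"
    and zero: "msum (fst \<rho>) (fst \<rho>) (snd \<rho>) H = 0\<^sub>m (fst \<rho>) (fst \<rho>)"
    and x: "x \<in> B" and y: "y \<in> B" and ij: "i < fst \<rho>" "j < fst \<rho>"
  shows "(\<Sum>k\<in>G. of_int (coeff R B (x \<otimes> y) k) * snd \<rho> k $$ (i, j)) =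
    (if x \<in> G \<and> y \<in> G then (snd \<rho> x * snd \<rho> y) $$ (i, j) else 0)"
proof -
  have car: "snd \<rho> g \<in> carrier_mat (fst \<rho>) (fst \<rho>)" if "g \<in> G" for g
    using group_rep_carrier[OF group_inv_group \<rho> that] .
  have mult: "snd \<rho> (g \<otimes> h) = snd \<rho> g * snd \<rho> h" if "g \<in> G" "h \<in> G" for g h
    using group_rep_mult[OF group_inv_group \<rho> that] by (simp add: inv_group_simps)
  consider "x \<in> G" "y \<in> G" | "x \<otimes> y \<in> X" "\<not> (x \<in> G \<and> y \<in> G)" | "x \<in> X" "y \<in> X"
    using x y noninv_mult_left noninv_mult_right by (metis DiffI)
  then show ?thesis
  proof cases
    case 1
    have "(\<Sum>k\<in>G. of_int (coeff R B (x \<otimes> y) k) * snd \<rho> k $$ (i, j)) =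
      (\<Sum>k\<in>G. if k = x \<otimes> y then snd \<rho> k $$ (i, j) else 0)"
      using mult_in_G[OF 1] G_basis coeff_basis by (intro sum.cong) auto
    then show ?thesis using 1 mult_in_G[OF 1] finite_G mult by simp
  next
    case 2
    then show ?thesis using coeff_basis[of "x \<otimes> y"] by (auto intro!: sum.neutral)
  next
    case 3
    obtain k where k: "k \<in> G" "x = k \<otimes> star y"
      using noninv_transitive[OF noninv_star[OF 3(2)] 3(1)] .
    have "(\<Sum>g\<in>G. of_int (coeff R B (x \<otimes> y) g) * snd \<rho> g $$ (i, j)) =
      (\<Sum>g\<in>G. if g \<otimes> star y = k \<otimes> star y then snd \<rho> g $$ (i, j) else 0)"
      using coeff_group_element[OF x y] k(2) by (intro sum.cong) auto
    also have "\<dots> = (\<Sum>g\<in>{g \<in> G. g \<otimes> star y = k \<otimes> star y}. snd \<rho> g $$ (i, j))"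
      using finite_G by (simp add: sum.inter_filter)
    also have "\<dots> = (\<Sum>g\<in>(\<lambda>h. k \<otimes> h) ` H. snd \<rho> g $$ (i, j))"
      using transporter_eq_coset[OF noninv_star[OF 3(2)] k(1)] by simp
    also have "\<dots> = (\<Sum>h\<in>H. snd \<rho> (k \<otimes> h) $$ (i, j))"
    proof (rule sum.reindex[unfolded o_def])
      show "inj_on ((\<otimes>) k) H"
      proof (rule inj_on_inverseI)
        fix h assume "h \<in> H"
        then have "h \<in> carrier R" using H_subset G_basis basis_closed by blast
        then show "star k \<otimes> (k \<otimes> h) = h" by (rule star_cancel(1)[OF k(1)])
      qed
    qed
    also have "\<dots> = msum (fst \<rho>) (fst \<rho>) (\<lambda>h. snd \<rho> k * snd \<rho> h) H $$ (i, j)"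
      unfolding msum_index[OF ij] using mult[OF k(1)] H_subset by (intro sum.cong refl) auto
    also have "msum (fst \<rho>) (fst \<rho>) (\<lambda>h. snd \<rho> k * snd \<rho> h) H = snd \<rho> k * msum (fst \<rho>) (fst \<rho>) (snd \<rho>) H"
      using car k(1) H_subset by (intro mult_msum[symmetric]) auto
    also have "\<dots> = 0\<^sub>m (fst \<rho>) (fst \<rho>)" using car[OF k(1)] by (simp add: zero)
    finally show ?thesis using 3 ij by simp
  qed
qed

lemma extend_rep_mult:
  assumes \<rho>: "group_rep (inv_group R B star) \<rho>"
    and zero: "msum (fst \<rho>) (fst \<rho>) (snd \<rho>) H = 0\<^sub>m (fst \<rho>) (fst \<rho>)"
  shows "snd (extend_rep \<rho>) (f \<otimes>\<^bsub>A\<^esub> g) = snd (extend_rep \<rho>) f * snd (extend_rep \<rho>) g" (is "?L = ?E f * ?E g")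
proof (rule eq_matI)
  let ?n = "fst \<rho>"
  have car: "snd \<rho> g \<in> carrier_mat (fst \<rho>) (fst \<rho>)" if "g \<in> G" for g
    using group_rep_carrier[OF group_inv_group \<rho> that] .
  have E: "?E f \<in> carrier_mat ?n ?n" for f by (rule extend_rep_carrier)
  fix i j assume "i < dim_row (?E f * ?E g)" "j < dim_col (?E f * ?E g)"
  then have ij: "i < ?n" "j < ?n" using E[of f] E[of g] by auto
  have "?L $$ (i, j) = (\<Sum>k\<in>G. (\<Sum>x\<in>B. \<Sum>y\<in>B. f x * g y * of_int (coeff R B (x \<otimes> y) k)) * snd \<rho> k $$ (i, j))"
    by (simp add: extend_rep_index[OF \<rho> ij] complexification_simps)
  also have "\<dots> = (\<Sum>k\<in>G. \<Sum>x\<in>B. \<Sum>y\<in>B. f x * g y * (of_int (coeff R B (x \<otimes> y) k) * snd \<rho> k $$ (i, j)))"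
    by (simp add: sum_distrib_right mult.assoc)
  also have "\<dots> = (\<Sum>x\<in>B. \<Sum>k\<in>G. \<Sum>y\<in>B. f x * g y * (of_int (coeff R B (x \<otimes> y) k) * snd \<rho> k $$ (i, j)))"
    by (rule sum.swap)
  also have "\<dots> = (\<Sum>x\<in>B. \<Sum>y\<in>B. \<Sum>k\<in>G. f x * g y * (of_int (coeff R B (x \<otimes> y) k) * snd \<rho> k $$ (i, j)))"
    by (intro sum.cong refl sum.swap)
  also have "\<dots> = (\<Sum>x\<in>B. \<Sum>y\<in>B. f x * g y * (if x \<in> G \<and> y \<in> G then (snd \<rho> x * snd \<rho> y) $$ (i, j) else 0))"
    using sum_structure_constants[OF \<rho> zero _ _ ij]
    by (intro sum.cong refl) (simp add: sum_distrib_left[symmetric])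
  also have "\<dots> = (\<Sum>x\<in>G. \<Sum>y\<in>B. f x * g y * (if x \<in> G \<and> y \<in> G then (snd \<rho> x * snd \<rho> y) $$ (i, j) else 0))"
    using G_basis finite_basis by (intro sum.mono_neutral_right) auto
  also have "\<dots> = (\<Sum>x\<in>G. \<Sum>y\<in>G. f x * g y * (if x \<in> G \<and> y \<in> G then (snd \<rho> x * snd \<rho> y) $$ (i, j) else 0))"
    using G_basis finite_basis by (intro sum.cong refl sum.mono_neutral_right) auto
  also have "\<dots> = (\<Sum>x\<in>G. \<Sum>y\<in>G. f x * g y * (\<Sum>l\<in>{0..<?n}. snd \<rho> x $$ (i, l) * snd \<rho> y $$ (l, j)))"
  proof (intro sum.cong refl)
    fix x y assume "x \<in> G" "y \<in> G"
    then show "f x * g y * (if x \<in> G \<and> y \<in> G then (snd \<rho> x * snd \<rho> y) $$ (i, j) else 0) =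
      f x * g y * (\<Sum>l\<in>{0..<?n}. snd \<rho> x $$ (i, l) * snd \<rho> y $$ (l, j))"
      using car[of x] car[of y] ij by (simp add: scalar_prod_def)
  qed
  also have "\<dots> = (\<Sum>x\<in>G. \<Sum>y\<in>G. \<Sum>l\<in>{0..<?n}. (f x * snd \<rho> x $$ (i, l)) * (g y * snd \<rho> y $$ (l, j)))"
    by (simp add: sum_distrib_left mult.assoc mult.left_commute)
  also have "\<dots> = (\<Sum>x\<in>G. \<Sum>l\<in>{0..<?n}. \<Sum>y\<in>G. (f x * snd \<rho> x $$ (i, l)) * (g y * snd \<rho> y $$ (l, j)))"
    by (intro sum.cong refl sum.swap)
  also have "\<dots> = (\<Sum>l\<in>{0..<?n}. \<Sum>x\<in>G. \<Sum>y\<in>G. (f x * snd \<rho> x $$ (i, l)) * (g y * snd \<rho> y $$ (l, j)))"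
    by (rule sum.swap)
  also have "\<dots> = (\<Sum>l\<in>{0..<?n}. ?E f $$ (i, l) * ?E g $$ (l, j))"
    using ij by (simp add: extend_rep_index[OF \<rho>] sum_product)
  also have "\<dots> = (?E f * ?E g) $$ (i, j)"
    using ij E[of f] E[of g] by (simp add: scalar_prod_def)
  finally show "?L $$ (i, j) = (?E f * ?E g) $$ (i, j)" .
qed (simp_all only: extend_rep_def snd_conv index_mult_mat msum_dim)

lemma algebra_rep_extend_rep:
  assumes \<rho>: "group_rep (inv_group R B star) \<rho>"
    and zero: "msum (fst \<rho>) (fst \<rho>) (snd \<rho>) H = 0\<^sub>m (fst \<rho>) (fst \<rho>)"
  shows "algebra_rep A (extend_rep \<rho>)"
  unfolding algebra_rep_def
proof (intro conjI allI ballI ring_hom_memI)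
  let ?n = "fst \<rho>" and ?M = "ring_mat TYPE(complex) (fst (extend_rep \<rho>)) ()"
  have c: "dim_row (snd (extend_rep \<rho>) f) = ?n" "dim_col (snd (extend_rep \<rho>) f) = ?n" for f
    by (simp_all add: extend_rep_def)
  show "snd (extend_rep \<rho>) f \<in> carrier ?M" for f
    by (simp add: ring_mat_simps extend_rep_carrier)
  show "snd (extend_rep \<rho>) (f \<otimes>\<^bsub>A\<^esub> g) = snd (extend_rep \<rho>) f \<otimes>\<^bsub>?M\<^esub> snd (extend_rep \<rho>) g" for f g
    by (simp add: ring_mat_simps extend_rep_mult[OF assms])
  show "snd (extend_rep \<rho>) (f \<oplus>\<^bsub>A\<^esub> g) = snd (extend_rep \<rho>) f \<oplus>\<^bsub>?M\<^esub> snd (extend_rep \<rho>) g" for f g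
    by (intro eq_matI) (auto simp: ring_mat_simps c extend_rep_index[OF \<rho>]
        complexification_simps distrib_right sum.distrib)
  show "snd (extend_rep \<rho>) (a \<odot>\<^bsub>A\<^esub> f) = a \<cdot>\<^sub>m snd (extend_rep \<rho>) f" for a f
    by (intro eq_matI) (auto simp: c extend_rep_index[OF \<rho>]
        complexification_simps sum_distrib_left mult.assoc)
  show "snd (extend_rep \<rho>) \<one>\<^bsub>A\<^esub> = \<one>\<^bsub>?M\<^esub>"
    using extend_rep_to_complex[OF \<rho> one_in_basis] one_in_G group_rep_one[OF group_inv_group \<rho>]
    by (simp add: complexification_simps ring_mat_simps inv_group_simps)
qed

text \<open>Evaluate the representation at \<open>x x\<^sup>*\<close> for some \<open>x \<in> X\<close>: it vanishes on both factors, while the group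
elements that occur in the product are exactly those of \<open>H\<close>, each with coefficient \<open>1\<close>.\<close>

lemma msum_stabilizer_zero:
  assumes \<psi>: "algebra_rep A \<psi>" and zero: "vanishes_on_noninv \<psi>"
  shows "msum (fst \<psi>) (fst \<psi>) (snd (restrict_rep \<psi>)) H = 0\<^sub>m (fst \<psi>) (fst \<psi>)"
proof -
  obtain x where x: "x \<in> X" using noninv_nonempty by auto
  let ?n = "fst \<psi>" and ?T = "\<lambda>x. snd \<psi> (to_complex R B x)"
  have xs: "x \<in> B" "star x \<in> B" "star x \<in> X" using x noninv_star star_closed by auto
  have xc: "x \<in> carrier R" "star x \<in> carrier R" using xs basis_closed by auto
  have z: "?T x = 0\<^sub>m ?n ?n" "?T (star x) = 0\<^sub>m ?n ?n"
    using zero x xs by (auto simp: vanishes_on_noninv_def)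
  have "?T (x \<otimes> star x) = ?T x * ?T (star x)"
    using algebra_rep_mult[OF \<psi> to_complex_closed[OF xc(1)] to_complex_closed[OF xc(2)]]
    by (simp add: to_complex_mult xs)
  then have 0: "?T (x \<otimes> star x) = 0\<^sub>m ?n ?n" by (simp add: z)
  show ?thesis
  proof (rule eq_matI)
    fix i j assume "i < dim_row (0\<^sub>m ?n ?n :: complex mat)" "j < dim_col (0\<^sub>m ?n ?n :: complex mat)"
    then have ij: "i < ?n" "j < ?n" by auto
    have "0 = ?T (x \<otimes> star x) $$ (i, j)" using ij by (simp add: 0)
    also have "\<dots> = snd (extend_rep (restrict_rep \<psi>)) (to_complex R B (x \<otimes> star x)) $$ (i, j)"
      using extend_restrict_rep[OF assms to_complex_closed] xc by simp
    also have "\<dots> = (\<Sum>g\<in>G. of_int (coeff R B (x \<otimes> star x) g) * snd (restrict_rep \<psi>) g $$ (i, j))"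
      using ij by (simp add: extend_rep_index[OF group_rep_restrict_rep[OF \<psi>]] to_complex_def)
    also have "\<dots> = (\<Sum>g\<in>G. if g \<otimes> x = x then snd (restrict_rep \<psi>) g $$ (i, j) else 0)"
      using coeff_group_element[OF xs(1,2)] star_star[OF xs(1)] by (intro sum.cong) auto
    also have "\<dots> = (\<Sum>g\<in>H. snd (restrict_rep \<psi>) g $$ (i, j))"
      unfolding stab_group_eq[OF x] using finite_G by (simp add: sum.inter_filter)
    finally show "msum ?n ?n (snd (restrict_rep \<psi>)) H $$ (i, j) = 0\<^sub>m ?n ?n $$ (i, j)"
      using ij by simp
  qed auto
qed

abbreviation H_group :: "'a monoid" where
  "H_group \<equiv> (inv_group R B star)\<lparr>carrier := H\<rparr>"

lemma sum_of_nontrivial_H_iff: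
  assumes \<rho>: "group_rep (inv_group R B star) \<rho>"
  shows "sum_of_nontrivial H_group \<rho> \<longleftrightarrow>
    msum (fst \<rho>) (fst \<rho>) (snd \<rho>) H = 0\<^sub>m (fst \<rho>) (fst \<rho>)"
proof -
  have gH: "group H_group" by (rule subgroup.subgroup_is_group[OF subgroup_H group_inv_group])
  have "finite (carrier H_group)" using finite_G H_subset by (simp add: finite_subset)
  moreover have "group_rep H_group \<rho>"
    using \<rho> H_subset unfolding group_rep_iff[OF gH] group_rep_iff[OF group_inv_group] by auto
  ultimately show ?thesis using sum_of_nontrivial_iff[OF gH] by simp
qed

section \<open>Formal codegrees and the bijection\<close>

lemma irreducible_restrict_rep:
  assumes \<psi>: "algebra_rep A \<psi>" and irr: "irreducible_on (carrier A) \<psi>" and zero: "vanishes_on_noninv \<psi>"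
  shows "irreducible_on (carrier A) (extend_rep (restrict_rep \<psi>))"
    and "irreducible_on G (restrict_rep \<psi>)"
proof -
  show e: "irreducible_on (carrier A) (extend_rep (restrict_rep \<psi>))"
    using irr extend_restrict_rep[OF \<psi> zero] by (simp add: irreducible_on_def)
  show "irreducible_on G (restrict_rep \<psi>)"
    using e irreducible_on_extend_rep[OF group_rep_restrict_rep[OF \<psi>]] by simp
qed

text \<open>At a group element \<open>g\<close> the coefficient of the codegree element is the trace of \<open>g\<^sup>* = g\<inverse>\<close>. The
coefficients at \<open>X\<close> do not contribute, because the representation vanishes there.\<close>

lemma formal_codegree_vanishing:
  assumes \<psi>: "algebra_rep A \<psi>" and irr: "irreducible_on (carrier A) \<psi>" and zero: "vanishes_on_noninv \<psi>"
  shows "formal_codegree R B star \<psi> = of_nat (Coset.order (inv_group R B star)) / of_nat (fst \<psi>)"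
proof -
  let ?n = "fst \<psi>" and ?\<rho> = "restrict_rep \<psi>" and ?c = "codegree_element R B star \<psi>"
  let ?q = "of_nat (Coset.order (inv_group R B star)) / of_nat ?n :: complex"
  have \<rho>: "group_rep (inv_group R B star) ?\<rho>" by (rule group_rep_restrict_rep[OF \<psi>])
  have n0: "?n \<noteq> 0" using irr by (simp add: irreducible_on_def)
  have irr\<rho>: "irreducible_on G ?\<rho>" by (rule irreducible_restrict_rep(2)[OF assms])
  have tc: "snd \<psi> (to_complex R B x) \<in> carrier_mat ?n ?n" if "x \<in> B" for x
    using algebra_rep_carrier[OF \<psi> to_complex_closed] basis_closed that by simp
  have rt: "rep_trace \<psi> (to_complex R B x) = tr (snd \<psi> (to_complex R B x))" for x
    by (simp add: rep_trace_def diag_mat_def tr_def interv_sum_list_conv_sum_set_nat lessThan_atLeast0)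
  have c_closed: "tr (snd \<psi> (to_complex R B x)) \<odot>\<^bsub>A\<^esub> to_complex R B (star x) \<in> carrier A" if "x \<in> B" for x
    using to_complex_closed[of "star x"] star_closed basis_closed that by (simp add: complexification_simps)
  have c: "?c = (\<lambda>z. \<Sum>x\<in>B. tr (snd \<psi> (to_complex R B x)) * to_complex R B (star x) z)"
    unfolding codegree_element_def rt
    by (subst finsum_complexification[OF finite_basis c_closed]) (simp_all add: complexification_simps)
  have cA: "?c \<in> carrier A"
    using to_complex_closed star_closed basis_closed unfolding c
    by (auto simp: complexification_simps intro!: sum.neutral)
  have cg: "?c g = tr (snd ?\<rho> (star g))" if g: "g \<in> G" for g
  proof -
    have "?c g = (\<Sum>x\<in>B. if x = star g then tr (snd \<psi> (to_complex R B x)) else 0)"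
      unfolding c using star_closed star_star G_basis[OF g]
      by (intro sum.cong refl) (auto simp: to_complex_basis)
    then show ?thesis using star_closed[OF G_basis[OF g]] finite_basis by (simp add: restrict_rep_def)
  qed
  have "snd \<psi> ?c = msum ?n ?n (\<lambda>g. ?c g \<cdot>\<^sub>m snd ?\<rho> g) G"
    using extend_restrict_rep[OF \<psi> zero cA] by (simp add: extend_rep_def)
  also have "\<dots> = msum ?n ?n (\<lambda>g. tr (snd ?\<rho> (star g)) \<cdot>\<^sub>m snd ?\<rho> (star (star g))) G"
    using cg star_star G_basis by (intro msum_cong) simp
  \<comment> \<open>The involution permutes the group, so g may be replaced by its inverse.\<close>
  also have "\<dots> = msum ?n ?n (\<lambda>g. tr (snd ?\<rho> g) \<cdot>\<^sub>m snd ?\<rho> (star g)) G"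
    by (rule msum_reindex, rule bij_betw_byWitness[where f' = star])
      (use star_in_G star_star G_basis in auto)
  also have "\<dots> = msum ?n ?n (\<lambda>g. tr (snd ?\<rho> g) \<cdot>\<^sub>m snd ?\<rho> (inv\<^bsub>inv_group R B star\<^esub> g)) G"
    by (intro msum_cong) (simp add: inv_group_inv)
  also have "\<dots> = ?q \<cdot>\<^sub>m 1\<^sub>m ?n"
    using sum_character_irreducible[OF group_inv_group \<rho> irr\<rho>] by simp
  finally have q: "snd \<psi> ?c = ?q \<cdot>\<^sub>m 1\<^sub>m ?n" .
  show ?thesis unfolding formal_codegree_def
  proof (rule the_equality)
    show "snd \<psi> ?c = ?q \<cdot>\<^sub>m 1\<^sub>m ?n" by (rule q)
    fix a assume "snd \<psi> ?c = a \<cdot>\<^sub>m 1\<^sub>m ?n"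
    then have "(a \<cdot>\<^sub>m 1\<^sub>m ?n) $$ (0, 0) = (?q \<cdot>\<^sub>m 1\<^sub>m ?n) $$ (0, 0)" using q by simp
    then show "a = ?q" using n0 by simp
  qed
qed

lemma Irr_zero_iff:
  "\<Psi> \<in> Irr_zero R B star \<longleftrightarrow> \<Psi> \<in> Irr_algebra A \<and> (\<forall>\<psi>\<in>\<Psi>. vanishes_on_noninv \<psi>)"
  by (auto simp: Irr_zero_def vanishes_on_noninv_def)

lemma Irr_rel_Irr_zero_bijection:
  "\<exists>F. bij_betw F (Irr_rel (inv_group R B star) H) (Irr_zero R B star)"
proof -
  define IG where "IG = {\<rho>. group_rep (inv_group R B star) \<rho> \<and> irreducible_on G \<rho>}"
  define IA where "IA = {\<psi>. algebra_rep A \<psi> \<and> irreducible_on (carrier A) \<psi>}"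
  define r where "r = {(\<rho>, \<sigma>). \<rho> \<in> IG \<and> \<sigma> \<in> IG \<and> rep_iso_on G \<rho> \<sigma>}"
  define s where "s = {(\<psi>, \<phi>). \<psi> \<in> IA \<and> \<phi> \<in> IA \<and> rep_iso_on (carrier A) \<psi> \<phi>}"
  have r_iff: "(\<rho>, \<sigma>) \<in> r \<longleftrightarrow> \<rho> \<in> IG \<and> \<sigma> \<in> IG \<and> rep_iso_on G \<rho> \<sigma>" for \<rho> \<sigma>
    by (simp add: r_def)
  have s_iff: "(\<psi>, \<phi>) \<in> s \<longleftrightarrow> \<psi> \<in> IA \<and> \<phi> \<in> IA \<and> rep_iso_on (carrier A) \<psi> \<phi>" for \<psi> \<phi>
    by (simp add: s_def)
  have IG: "group_rep (inv_group R B star) \<rho>" "irreducible_on G \<rho>" if "\<rho> \<in> IG" for \<rho>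
    using that by (simp_all add: IG_def)
  have IA: "algebra_rep A \<psi>" "irreducible_on (carrier A) \<psi>" if "\<psi> \<in> IA" for \<psi>
    using that by (simp_all add: IA_def)
  have carG: "snd \<rho> g \<in> carrier_mat (fst \<rho>) (fst \<rho>)" if "\<rho> \<in> IG" "g \<in> G" for \<rho> g
    using group_rep_carrier[OF group_inv_group IG(1)] that by blast
  have carA: "snd \<psi> f \<in> carrier_mat (fst \<psi>) (fst \<psi>)" if "\<psi> \<in> IA" "f \<in> carrier A" for \<psi> f
    using algebra_rep_carrier[OF IA(1)] that by blast
  have ext: "extend_rep \<rho> \<in> IA" "vanishes_on_noninv (extend_rep \<rho>)"
    if \<rho>: "\<rho> \<in> IG" and nt: "sum_of_nontrivial H_group \<rho>" for \<rho>
  proof -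
    have "msum (fst \<rho>) (fst \<rho>) (snd \<rho>) H = 0\<^sub>m (fst \<rho>) (fst \<rho>)"
      using nt sum_of_nontrivial_H_iff[OF IG(1)[OF \<rho>]] by blast
    then show "extend_rep \<rho> \<in> IA"
      using algebra_rep_extend_rep[OF IG(1)[OF \<rho>]] irreducible_on_extend_rep[OF IG(1)[OF \<rho>]] IG(2)[OF \<rho>]
      unfolding IA_def by blast
    show "vanishes_on_noninv (extend_rep \<rho>)"
      unfolding vanishes_on_noninv_def fst_extend_rep
      using extend_rep_to_complex[OF IG(1)[OF \<rho>]] by (metis DiffD1 DiffD2)
  qed
  have res: "restrict_rep \<psi> \<in> IG" "sum_of_nontrivial H_group (restrict_rep \<psi>)"
    if \<psi>: "\<psi> \<in> IA" and zero: "vanishes_on_noninv \<psi>" for \<psi>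
  proof -
    have \<rho>: "group_rep (inv_group R B star) (restrict_rep \<psi>)" by (rule group_rep_restrict_rep[OF IA(1)[OF \<psi>]])
    show "restrict_rep \<psi> \<in> IG"
      unfolding IG_def using \<rho> irreducible_restrict_rep(2)[OF IA[OF \<psi>] zero] by blast
    show "sum_of_nontrivial H_group (restrict_rep \<psi>)"
      using msum_stabilizer_zero[OF IA(1)[OF \<psi>] zero] sum_of_nontrivial_H_iff[OF \<rho>] by simp
  qed
  have "bij_betw (\<lambda>C. s `` (extend_rep ` C))
    {C \<in> IG // r. \<forall>\<rho>\<in>C. sum_of_nontrivial H_group \<rho>} {D \<in> IA // s. \<forall>\<psi>\<in>D. vanishes_on_noninv \<psi>}"
  proof (rule bij_betw_quotients[where g = restrict_rep])
    show "equiv IG r" unfolding r_def by (rule equiv_rep_iso_on[OF carG])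
    show "equiv IA s" unfolding s_def by (rule equiv_rep_iso_on[OF carA])
  next
    fix \<rho> \<sigma> assume a: "(\<rho>, \<sigma>) \<in> r" "sum_of_nontrivial H_group \<rho>"
    then have \<rho>: "\<rho> \<in> IG" and \<sigma>: "\<sigma> \<in> IG" and iso: "rep_iso_on G \<rho> \<sigma>" by (simp_all add: r_iff)
    have "rep_iso_on H \<rho> \<sigma>" using iso H_subset unfolding rep_iso_on_def by blast
    moreover have "msum (fst \<rho>) (fst \<rho>) (snd \<rho>) H = 0\<^sub>m (fst \<rho>) (fst \<rho>)"
      using a(2) sum_of_nontrivial_H_iff[OF IG(1)[OF \<rho>]] by blast
    ultimately have "msum (fst \<sigma>) (fst \<sigma>) (snd \<sigma>) H = 0\<^sub>m (fst \<sigma>) (fst \<sigma>)"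
      using rep_iso_on_msum_zero[OF rep_iso_on_sym carG[OF \<sigma>]] H_subset by blast
    then show "sum_of_nontrivial H_group \<sigma>"
      using sum_of_nontrivial_H_iff[OF IG(1)[OF \<sigma>]] by blast
  next
    fix \<psi> \<phi> assume a: "(\<psi>, \<phi>) \<in> s" "vanishes_on_noninv \<psi>"
    show "vanishes_on_noninv \<phi>" unfolding vanishes_on_noninv_def
    proof
      fix x assume x: "x \<in> X"
      then have xc: "x \<in> carrier R" using basis_closed by simp
      have z: "snd \<psi> (to_complex R B x) = 0\<^sub>m (fst \<psi>) (fst \<psi>)"
        using a(2) x by (simp add: vanishes_on_noninv_def)
      have iso: "rep_iso_on (carrier A) \<psi> \<phi>" using a(1) by (simp add: s_iff)
      show "snd \<phi> (to_complex R B x) = 0\<^sub>m (fst \<phi>) (fst \<phi>)"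
        by (rule rep_iso_on_zero[OF iso to_complex_closed[OF xc] z])
    qed
  next
    fix \<rho> assume "\<rho> \<in> IG" "sum_of_nontrivial H_group \<rho>"
    then show "extend_rep \<rho> \<in> IA \<and> vanishes_on_noninv (extend_rep \<rho>)" using ext by blast
  next
    fix \<psi> assume "\<psi> \<in> IA" "vanishes_on_noninv \<psi>"
    then show "restrict_rep \<psi> \<in> IG \<and> sum_of_nontrivial H_group (restrict_rep \<psi>)" using res by blast
  next
    fix \<rho> \<sigma> assume "(\<rho>, \<sigma>) \<in> r" "sum_of_nontrivial H_group \<rho>" "sum_of_nontrivial H_group \<sigma>"
    then show "(extend_rep \<rho>, extend_rep \<sigma>) \<in> s"
      unfolding r_iff s_iff by (simp add: ext(1) IG(1) rep_iso_on_extend_rep)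
  next
    fix \<psi> \<phi> assume "(\<psi>, \<phi>) \<in> s" "vanishes_on_noninv \<psi>" "vanishes_on_noninv \<phi>"
    then show "(restrict_rep \<psi>, restrict_rep \<phi>) \<in> r"
      unfolding r_iff s_iff by (simp add: res(1) rep_iso_on_restrict_rep)
  next
    fix \<rho> assume a: "\<rho> \<in> IG" "sum_of_nontrivial H_group \<rho>"
    have "snd (restrict_rep (extend_rep \<rho>)) g = snd \<rho> g" if "g \<in> G" for g
      using extend_rep_to_complex[OF IG(1)[OF a(1)] G_basis[OF that]] that by (simp add: restrict_rep_def)
    then have "rep_iso_on G \<rho> (restrict_rep (extend_rep \<rho>))"
      using rep_iso_on_refl[of G \<rho>] carG[OF a(1)] unfolding rep_iso_on_def by simp
    then show "(\<rho>, restrict_rep (extend_rep \<rho>)) \<in> r"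
      unfolding r_iff by (simp add: a(1) res(1) ext[OF a])
  next
    fix \<psi> assume a: "\<psi> \<in> IA" "vanishes_on_noninv \<psi>"
    have "rep_iso_on (carrier A) \<psi> (extend_rep (restrict_rep \<psi>))"
      using rep_iso_on_refl[of "carrier A" \<psi>] carA[OF a(1)] extend_restrict_rep[OF IA(1)[OF a(1)] a(2)]
      unfolding rep_iso_on_def by simp
    then show "(\<psi>, extend_rep (restrict_rep \<psi>)) \<in> s"
      unfolding s_iff by (simp add: a(1) ext(1) res[OF a])
  qed
  moreover have "{C \<in> IG // r. \<forall>\<rho>\<in>C. sum_of_nontrivial H_group \<rho>} = Irr_rel (inv_group R B star) H"
    unfolding Irr_rel_def Irr_group_def iso_classes_def IG_def[symmetric] r_def[symmetric] ..
  moreover have "{D \<in> IA // s. \<forall>\<psi>\<in>D. vanishes_on_noninv \<psi>} = Irr_zero R B star"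
    unfolding Irr_zero_def Irr_algebra_def iso_classes_def IA_def[symmetric] s_def[symmetric]
      vanishes_on_noninv_def ..
  ultimately show ?thesis by auto
qed

end

theorem proposition2p9:
  fixes R :: "('a, 'm) ring_scheme" and B :: "'a set" and star :: "'a \<Rightarrow> 'a"
  assumes "fusion_ring R B star"
    and "card (basis_orbits R B star) = 2"
  shows "(\<exists>F. bij_betw F (Irr_rel (inv_group R B star) (stab_group R B star))
                         (Irr_zero R B star)) \<and>
         (\<forall>\<Psi> \<in> Irr_zero R B star. \<forall>\<psi> \<in> \<Psi>.
            formal_codegree R B star \<psi> =
              of_nat (Coset.order (inv_group R B star)) / of_nat (fst \<psi>))"
proof -
  interpret two_orbit_fusion_ring R B star
    using assms by (simp add: two_orbit_fusion_ring_def two_orbit_fusion_ring_axioms_def)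
  have "formal_codegree R B star \<psi> = of_nat (Coset.order (inv_group R B star)) / of_nat (fst \<psi>)"
    if \<Psi>: "\<Psi> \<in> Irr_zero R B star" and \<psi>: "\<psi> \<in> \<Psi>" for \<Psi> \<psi>
  proof -
    have "algebra_rep A \<psi>" "irreducible_on (carrier A) \<psi>"
      using \<Psi> \<psi> by (auto simp: Irr_zero_iff Irr_algebra_def iso_classes_def elim!: quotientE)
    then show ?thesis using formal_codegree_vanishing \<Psi> \<psi> by (simp add: Irr_zero_iff)
  qed
  then show ?thesis using Irr_rel_Irr_zero_bijection by blast
qed

end
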